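(* For any $\alpha\in\mathbb{R}$: (i) for all $P,Q\in M$, $\mathcal{D}_{-\alpha}(P\,|\,Q)=\mathcal{D}_\alpha(Q\,|\,P)\ge 0$, with equality to $0$ if and only if $P=Q$; (ii) for all $P,Q,R\in M$, $$\mathcal{D}_\alpha(P\,|\,R)=\mathcal{D}_\alpha(P\,|\,Q)+\mathcal{D}_\alpha(Q\,|\,R)-\langle\phi_\alpha(P)-\phi_\alpha(Q),\,\phi_{-\alpha}(R)-\phi_{-\alpha}(Q)\rangle_{L^2(\mu)};$$ (iii) the set $\phi_\alpha(M)$ is convex; (iv) for any $Q\in M$, the function $\mathcal{D}_\alpha(\phi_\alpha^{-1}|\,Q):\phi_\alpha(M)\to\mathbb{R}$, $a\mapsto\mathcal{D}_\alpha(\phi_\alpha^{-1}(a)\,|\,Q)$, admits the following first and second (Fréchet) derivatives at $a\in\phi_\alpha(M)$, for $u,v\in\mathbb{G}$: $$\mathcal{D}_\alpha(\phi_\alpha^{-1}|\,Q)_a^{(1)}u=\langle\phi_{-\alpha}\circ\phi_\alpha^{-1}(a)-\phi_{-\alpha}(Q),\,u\rangle_{L^2(\mu)},$$ $$\mathcal{D}_\alpha(\phi_\alpha^{-1}|\,Q)_a^{(2)}(u,v)=\mathbf{E}_\mu\left[\exp_{\mathbb{G}}\left(\alpha\,\phi_1\circ\phi_\alpha^{-1}(a)\right)\cdot u\cdot v\right];$$ in particular $\mathcal{D}_\alpha(\phi_\alpha^{-1}|\,Q)$ is strictly convex; (v) for any $Q\in M$ and $a\in\phi_{-\alpha}(M)$,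 $$\mathcal{D}_{-\alpha}(\phi_{-\alpha}^{-1}(a)\,|\,Q)=\max_{b\in\phi_\alpha(M)}\left\{\langle a-\phi_{-\alpha}(Q),\,b-\phi_\alpha(Q)\rangle_{L^2(\mu)}-\mathcal{D}_\alpha(\phi_\alpha^{-1}(b)\,|\,Q)\right\},$$ and the unique maximiser is $b=\phi_\alpha\circ\phi_{-\alpha}^{-1}(a)$.
   Context: Let $B$ be an open subset of a (real) Banach space $\mathbb{X}$, let $\mathcal{X}_B$ be the Borel $\sigma$-algebra of $B$, and let $\mu$ be a probability measure on $(B,\mathcal{X}_B)$ such that $\mu(A)>0$ for every non-empty open $A\in\mathcal{X}_B$. Fix $k\in\mathbb{N}_0$. $\mathbb{G}:=C_b^k(B;\mathbb{R})$ is the Banach space of bounded continuous functions $a:B\to\mathbb{R}$ with bounded continuous Fréchet derivatives $a^{(i)}$ of all orders $1\le i\le k$, with norm $\|a\|_{\mathbb{G}}=\sup_{x\in B}|a(x)|+\sum_{i=1}^k\sup_{x\in B}\|a_x^{(i)}\|_{L(\mathbb{X}^i;\mathbb{R})}$. Products $a\cdot b$ in $\mathbb{G}$ are pointwise, $\exp_{\mathbb{G}}(a)(x)=\exp(a(x))$, and $\mathbf{E}_\mu a=\int_B a\,d\mu$. $M$ is the set of finite measures $P$ on $(B,\mathcal{X}_B)$ that are mutually absolutely continuous with respect to $\mu$ and have densities $dP/d\mu=\exp_{\mathbb{G}}(a)$ for some $a\in\mathbb{G}$ (where $dP/d\mu$ denotes this version of the density). Define $\phi_1:M\to\mathbb{G}$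 by $\phi_1(P)=\log(dP/d\mu)$ (a bijection), and, for $\alpha\in\mathbb{R}\setminus\{1\}$, $\phi_\alpha:M\to\mathbb{G}$ by $$\phi_\alpha(P)=\tfrac{2}{1-\alpha}\left(\exp_{\mathbb{G}}\left(\tfrac{1-\alpha}{2}\phi_1(P)\right)-1\right).$$ Each $\phi_\alpha$ is injective with open image $\phi_\alpha(M)\subset\mathbb{G}$; in particular $\phi_{-1}(P)=dP/d\mu-1$. The $\alpha$-divergences $\mathcal{D}_\alpha(\cdot\,|\,\cdot):M\times M\to\mathbb{R}$ are defined by $$\mathcal{D}_{-1}(P\,|\,Q)=\mathcal{D}_1(Q\,|\,P)=\mathbf{E}_\mu(\phi_{-1}(Q)-\phi_{-1}(P))+\langle\phi_{-1}(P)+1,\,\phi_1(P)-\phi_1(Q)\rangle_{L^2(\mu)},$$ and, for $\alpha\ne\pm1$, $$\mathcal{D}_\alpha(P\,|\,Q)=\tfrac{2}{1+\alpha}\mathbf{E}_\mu(\phi_{-1}(P)-\phi_\alpha(P))+\tfrac{2}{1-\alpha}\mathbf{E}_\mu(\phi_{-1}(Q)-\phi_{-\alpha}(Q))-\langle\phi_\alpha(P),\phi_{-\alpha}(Q)\rangle_{L^2(\mu)}.$$ *)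

theory Defs
  imports "HOL-Probability.Probability" "HOL-Library.Function_Algebras"
begin

text \<open>
  Functions form a real vector space pointwise. Addition and multiplication come from
  \<^theory>\<open>HOL-Library.Function_Algebras\<close>; this instance makes the library notions such as
  \<^const>\<open>convex\<close> available for sets of functions.
\<close>

instantiation "fun" :: (type, real_vector) real_vector
begin

definition scaleR_fun :: "real \<Rightarrow> ('a \<Rightarrow> 'b) \<Rightarrow> 'a \<Rightarrow> 'b" where
  "scaleR_fun c f = (\<lambda>x. c *\<^sub>R f x)"

instance
  by standard (simp_all add: scaleR_fun_def fun_eq_iff algebra_simps)

end

lemma scaleR_fun_apply [simp]: "(c *\<^sub>R f) x = c *\<^sub>R f x"
  by (simp add: scaleR_fun_def)

text \<open>
  The spaces \<open>L(X\<^sup>i; \<real>)\<close> and \<open>C\<^sub>b\<^sup>k(B; \<real>)\<close> depend on the parameters \<open>i\<close>, \<open>k\<close>, \<open>B\<close> and so are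
  not types. A normed space is therefore given by a carrier inside a real vector space together
  with a norm function that is only meaningful on the carrier. The derivative below is the usual
  Frechet derivative at a point \<open>a\<close> of a map \<open>F\<close> from \<open>S \<subseteq> V\<close> to \<open>W\<close>; \<open>a\<close> is required to be an
  interior point of \<open>S\<close>, so the derivative is unique.
\<close>

definition bounded_linear_between ::
  "'v::real_vector set \<Rightarrow> ('v \<Rightarrow> real) \<Rightarrow> 'w::real_vector set \<Rightarrow> ('w \<Rightarrow> real) \<Rightarrow> ('v \<Rightarrow> 'w) \<Rightarrow> bool"
where
  "bounded_linear_between V nV W nW L \<longleftrightarrow>
     (\<forall>u\<in>V. L u \<in> W) \<and>
     (\<forall>u\<in>V. \<forall>v\<in>V. L (u + v) = L u + L v) \<and>
     (\<forall>c. \<forall>u\<in>V. L (c *\<^sub>R u) = c *\<^sub>R L u) \<and>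
     (\<exists>C. \<forall>u\<in>V. nW (L u) \<le> C * nV u)"

definition has_frechet_derivative_at ::
  "'v::real_vector set \<Rightarrow> ('v \<Rightarrow> real) \<Rightarrow> 'w::real_vector set \<Rightarrow> ('w \<Rightarrow> real) \<Rightarrow>
   'v set \<Rightarrow> ('v \<Rightarrow> 'w) \<Rightarrow> ('v \<Rightarrow> 'w) \<Rightarrow> 'v \<Rightarrow> bool"
where
  "has_frechet_derivative_at V nV W nW S F F' a \<longleftrightarrow>
     a \<in> S \<and> S \<subseteq> V \<and> (\<forall>b\<in>S. F b \<in> W) \<and>
     (\<exists>\<delta>>0. \<forall>h\<in>V. nV h < \<delta> \<longrightarrow> a + h \<in> S) \<and>
     bounded_linear_between V nV W nW F' \<and>
     (\<forall>\<epsilon>>0. \<exists>\<delta>>0. \<forall>h\<in>V. nV h < \<delta> \<longrightarrow> a + h \<in> S \<longrightarrow>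
        nW (F (a + h) - F a - F' h) \<le> \<epsilon> * nV h)"

text \<open>
  \<open>L(X\<^sup>i; \<real>)\<close>: an \<open>i\<close>-linear form takes its arguments as a list of length \<open>i\<close>, and is \<open>0\<close> on lists
  of any other length so that equality of forms is equality of HOL functions.
\<close>

definition mult_forms :: "nat \<Rightarrow> ('a::real_normed_vector list \<Rightarrow> real) set" where
  "mult_forms i =
     {T. (\<forall>us. length us \<noteq> i \<longrightarrow> T us = 0) \<and>
         (\<forall>us j. length us = i \<longrightarrow> j < i \<longrightarrow> linear (\<lambda>v. T (us[j := v]))) \<and>
         (\<exists>C. \<forall>us. length us = i \<longrightarrow> \<bar>T us\<bar> \<le> C * (\<Prod>u\<leftarrow>us. norm u))}"

definition mult_norm :: "nat \<Rightarrow> ('a::real_normed_vector list \<Rightarrow> real) \<Rightarrow> real" where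
  "mult_norm i T = (SUP us\<in>{us. length us = i \<and> (\<forall>u\<in>set us. norm u \<le> 1)}. \<bar>T us\<bar>)"

text \<open>
  \<open>iter_deriv a [u\<^sub>1, \<dots>, u\<^sub>i] x\<close> differentiates \<open>a\<close> in directions \<open>u\<^sub>i\<close>, \<dots>, \<open>u\<^sub>1\<close> successively. If
  \<open>a\<close> is \<open>i\<close> times Frechet differentiable, its \<open>i\<close>-th derivative at \<open>x\<close> must therefore be
  \<open>deriv_form a i x\<close>. Differentiability in the norm of \<open>L(X\<^sup>i; \<real>)\<close> is demanded in \<open>Cbk\<close>.
\<close>

primrec iter_deriv ::
  "('a::real_normed_vector \<Rightarrow> real) \<Rightarrow> 'a list \<Rightarrow> 'a \<Rightarrow> real"
where
  "iter_deriv a [] = a"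
| "iter_deriv a (u # us) = (\<lambda>x. frechet_derivative (iter_deriv a us) (at x) u)"

definition deriv_form ::
  "('a::real_normed_vector \<Rightarrow> real) \<Rightarrow> nat \<Rightarrow> 'a \<Rightarrow> 'a list \<Rightarrow> real"
where
  "deriv_form a i x = (\<lambda>us. if length us = i then iter_deriv a us x else 0)"

text \<open>
  The space \<open>C\<^sub>b\<^sup>k(B; \<real>)\<close>. A function on \<open>B\<close> is represented by its extension by \<open>0\<close> to the whole
  space. The derivative of order \<open>i + 1\<close> is the derivative of the derivative of order \<open>i\<close>, where
  \<open>L(X; L(X\<^sup>i; \<real>))\<close> is identified with \<open>L(X\<^bsup>i+1\<^esup>; \<real>)\<close> by \<open>T h us = T (h # us)\<close>.
\<close>

definition Cbk :: "nat \<Rightarrow> 'a::real_normed_vector set \<Rightarrow> ('a \<Rightarrow> real) set" where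
  "Cbk k B =
     {a. (\<forall>x. x \<notin> B \<longrightarrow> a x = 0) \<and> continuous_on B a \<and> bounded (a ` B) \<and>
         (\<forall>i<k. \<forall>x\<in>B. has_frechet_derivative_at UNIV norm (mult_forms i) (mult_norm i) B
            (deriv_form a i) (\<lambda>h us. deriv_form a (Suc i) x (h # us)) x) \<and>
         (\<forall>i\<in>{1..k}.
            (\<forall>x\<in>B. \<forall>\<epsilon>>0. \<exists>\<delta>>0. \<forall>y\<in>B. dist y x < \<delta> \<longrightarrow>
               mult_norm i (deriv_form a i y - deriv_form a i x) < \<epsilon>) \<and>
            bdd_above ((\<lambda>x. mult_norm i (deriv_form a i x)) ` B))}"

definition Cbk_norm :: "nat \<Rightarrow> 'a::real_normed_vector set \<Rightarrow> ('a \<Rightarrow> real) \<Rightarrow> real" where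
  "Cbk_norm k B a =
     (SUP x\<in>B. \<bar>a x\<bar>) + (\<Sum>i=1..k. SUP x\<in>B. mult_norm i (deriv_form a i x))"

text \<open>The topological dual \<open>L(G; \<real>)\<close> of \<open>G = C\<^sub>b\<^sup>k(B; \<real>)\<close>, with functionals set to \<open>0\<close> off \<open>G\<close>.\<close>

definition Cbk_dual ::
  "nat \<Rightarrow> 'a::real_normed_vector set \<Rightarrow> (('a \<Rightarrow> real) \<Rightarrow> real) set"
where
  "Cbk_dual k B =
     {L. bounded_linear_between (Cbk k B) (Cbk_norm k B) UNIV abs L \<and>
         (\<forall>u. u \<notin> Cbk k B \<longrightarrow> L u = 0)}"

definition Cbk_dual_norm ::
  "nat \<Rightarrow> 'a::real_normed_vector set \<Rightarrow> (('a \<Rightarrow> real) \<Rightarrow> real) \<Rightarrow> real"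
where
  "Cbk_dual_norm k B L = (SUP u\<in>{u \<in> Cbk k B. Cbk_norm k B u \<le> 1}. \<bar>L u\<bar>)"

definition exp_G :: "('a \<Rightarrow> real) \<Rightarrow> 'a \<Rightarrow> real" where
  "exp_G a = (\<lambda>x. exp (a x))"

definition M_set ::
  "nat \<Rightarrow> 'a::real_normed_vector set \<Rightarrow> 'a measure \<Rightarrow> 'a measure set"
where
  "M_set k B \<mu> =
     {P. finite_measure P \<and> sets P = sets \<mu> \<and>
         absolutely_continuous \<mu> P \<and> absolutely_continuous P \<mu> \<and>
         (\<exists>a\<in>Cbk k B. P = density \<mu> (\<lambda>x. ennreal (exp_G a x)))}"

definition dens ::
  "nat \<Rightarrow> 'a::real_normed_vector set \<Rightarrow> 'a measure \<Rightarrow> 'a measure \<Rightarrow> 'a \<Rightarrow> real"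
where
  "dens k B \<mu> P =
     (THE p. p \<in> exp_G ` Cbk k B \<and> P = density \<mu> (\<lambda>x. ennreal (p x)))"

text \<open>Off \<open>B\<close> the chosen density is \<open>1\<close>, so \<open>phi\<close> is \<open>0\<close> there, as required of members of \<open>Cbk k B\<close>.\<close>

definition phi ::
  "nat \<Rightarrow> 'a::real_normed_vector set \<Rightarrow> 'a measure \<Rightarrow> real \<Rightarrow> 'a measure \<Rightarrow> 'a \<Rightarrow> real"
where
  "phi k B \<mu> \<alpha> P =
     (let \<phi>1 = (\<lambda>x. ln (dens k B \<mu> P x))
      in if \<alpha> = 1 then \<phi>1
         else (2 / (1 - \<alpha>)) *\<^sub>R (exp_G (((1 - \<alpha>) / 2) *\<^sub>R \<phi>1) - 1))"

definition phi_inv ::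
  "nat \<Rightarrow> 'a::real_normed_vector set \<Rightarrow> 'a measure \<Rightarrow> real \<Rightarrow> ('a \<Rightarrow> real) \<Rightarrow> 'a measure"
where
  "phi_inv k B \<mu> \<alpha> = inv_into (M_set k B \<mu>) (phi k B \<mu> \<alpha>)"

definition ip :: "'a measure \<Rightarrow> ('a \<Rightarrow> real) \<Rightarrow> ('a \<Rightarrow> real) \<Rightarrow> real" where
  "ip \<mu> f g = (LINT x|\<mu>. f x * g x)"

definition divergence_m1 ::
  "nat \<Rightarrow> 'a::real_normed_vector set \<Rightarrow> 'a measure \<Rightarrow> 'a measure \<Rightarrow> 'a measure \<Rightarrow> real"
where
  "divergence_m1 k B \<mu> P Q =
     integral\<^sup>L \<mu> (phi k B \<mu> (-1) Q - phi k B \<mu> (-1) P) +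
     ip \<mu> (phi k B \<mu> (-1) P + 1) (phi k B \<mu> 1 P - phi k B \<mu> 1 Q)"

definition divergence ::
  "nat \<Rightarrow> 'a::real_normed_vector set \<Rightarrow> 'a measure \<Rightarrow> real \<Rightarrow> 'a measure \<Rightarrow> 'a measure \<Rightarrow> real"
where
  "divergence k B \<mu> \<alpha> P Q =
     (if \<alpha> = -1 then divergence_m1 k B \<mu> P Q
      else if \<alpha> = 1 then divergence_m1 k B \<mu> Q P
      else 2 / (1 + \<alpha>) * integral\<^sup>L \<mu> (phi k B \<mu> (-1) P - phi k B \<mu> \<alpha> P) +
           2 / (1 - \<alpha>) * integral\<^sup>L \<mu> (phi k B \<mu> (-1) Q - phi k B \<mu> (-\<alpha>) Q) -
           ip \<mu> (phi k B \<mu> \<alpha> P) (phi k B \<mu> (-\<alpha>) Q))"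

definition strictly_convex_on :: "'v::real_vector set \<Rightarrow> ('v \<Rightarrow> real) \<Rightarrow> bool" where
  "strictly_convex_on S F \<longleftrightarrow> convex S \<and>
     (\<forall>a\<in>S. \<forall>b\<in>S. \<forall>t. a \<noteq> b \<longrightarrow> 0 < t \<longrightarrow> t < 1 \<longrightarrow>
        F ((1 - t) *\<^sub>R a + t *\<^sub>R b) < (1 - t) * F a + t * F b)"

end

theory Submission
  imports Defs
begin

text \<open>
  Put \<open>\<beta> = (1 - \<alpha>) / 2\<close>. In terms of the log density \<open>p\<close> of a measure, the coordinate \<open>\<phi> \<alpha>\<close> is \<open>p\<close>
  followed by an increasing scalar function \<open>emb \<alpha>\<close> with derivative \<open>exp (\<beta> t)\<close>, and the divergence
  is the integral of a scalar divergence \<open>d\<^sub>\<alpha>(p(x), q(x))\<close>. Two facts about this scalar divergence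
  carry the statements about divergences. Its derivative in the first argument,
  \<open>exp (\<beta> s) * (emb (-\<alpha>) s - emb (-\<alpha>) t)\<close>, has the sign of \<open>s - t\<close>, so \<open>d\<^sub>\<alpha>\<close> is positive off the
  diagonal (\<open>pointwise_divergence_pos\<close>); and it satisfies the three-point identity
  (\<open>pointwise_divergence_three_point\<close>). Integration preserves both. Equality in part (i) uses that the
  integrand is continuous and that non-empty open sets have positive measure.

  Parts (iv) and (v) are consequences of the three-point identity. For \<open>P'\<close> with coordinate
  \<open>\<phi> \<alpha> P + h\<close>, the remainder of the first-order expansion of \<open>D \<alpha> (\<cdot>) Q\<close> at \<open>P\<close> is \<open>D \<alpha> P' P\<close>, and this
  is at most the pairing of \<open>h\<close> with \<open>\<phi> (-\<alpha>) P' - \<phi> (-\<alpha>) P\<close> (\<open>divergence_remainder\<close>). The first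
  derivative therefore comes down to a Lipschitz estimate for the transition between the coordinates
  \<open>\<alpha>\<close> and \<open>-\<alpha>\<close>, and the second derivative is the derivative of this transition
  (\<open>phi_transition_differentiable\<close>). The gap in the convexity inequality is a convex combination of
  divergences relative to the intermediate measure, and the gap in the variational formula is the
  divergence of the competitor relative to the claimed maximiser (\<open>legendre_gap\<close>).

  The analytic work lies in the image of \<open>\<phi> \<alpha>\<close>: it consists of the \<open>b \<in> C\<^sub>b\<^sup>k\<close> for which
  \<open>1 + \<beta> * b\<close> has a positive lower bound on \<open>B\<close> (\<open>phi_image_iff\<close>), and it is therefore convex and
  open. This requires that \<open>C\<^sub>b\<^sup>k\<close> is closed under sums and under composition with smooth scalar
  functions. To avoid the formula for iterated derivatives of a composite, \<open>C\<^sub>b\<^sup>k\<close> is described by a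
  recursive notion of smoothness for families of forms indexed by lists of directions
  (\<open>Cbk_iff_smooth_forms\<close>). The notion is stable under sums and products, and composition then
  follows by induction on the order from the chain rule (\<open>smooth_forms_compose\<close>).
\<close>

section \<open>Smooth families of forms\<close>

abbreviation norms_prod :: "'a::real_normed_vector list \<Rightarrow> real" where
  "norms_prod us \<equiv> (\<Prod>u\<leftarrow>us. norm u)"

text \<open>
  A family \<open>\<Phi>\<close> assigns to each list \<open>us\<close> of directions a scalar function; only its values on lists of
  one fixed length \<open>i\<close>, the degree, and at points of \<open>B\<close> matter. All estimates are uniform in the
  directions relative to the product of their norms, which is what estimates in \<open>L(X\<^sup>i; \<real>)\<close> say.
  Linearity in the directions is recovered later, from the differentiations (\<open>iter_deriv_multilinear\<close>).
\<close>

definition bounded_continuous_forms ::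
  "'a::real_normed_vector set \<Rightarrow> nat \<Rightarrow> ('a list \<Rightarrow> 'a \<Rightarrow> real) \<Rightarrow> bool" where
  "bounded_continuous_forms B i \<Phi> \<longleftrightarrow>
     (\<exists>C. \<forall>x\<in>B. \<forall>us. length us = i \<longrightarrow> \<bar>\<Phi> us x\<bar> \<le> C * norms_prod us) \<and>
     (\<forall>x\<in>B. \<forall>\<epsilon>>0. \<exists>\<delta>>0. \<forall>y\<in>B. dist y x < \<delta> \<longrightarrow>
        (\<forall>us. length us = i \<longrightarrow> \<bar>\<Phi> us y - \<Phi> us x\<bar> \<le> \<epsilon> * norms_prod us))"

text \<open>
  The new direction is put at the head of the list, so that \<^const>\<open>iter_deriv\<close> of a function is its
  own derivative in this sense.
\<close>

definition forms_derivative ::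
  "'a::real_normed_vector set \<Rightarrow> nat \<Rightarrow> ('a list \<Rightarrow> 'a \<Rightarrow> real) \<Rightarrow> ('a list \<Rightarrow> 'a \<Rightarrow> real) \<Rightarrow> bool"
where
  "forms_derivative B i \<Phi> \<Phi>' \<longleftrightarrow>
     (\<forall>x\<in>B. (\<forall>us. length us = i \<longrightarrow> linear (\<lambda>h. \<Phi>' (h # us) x)) \<and>
        (\<forall>\<epsilon>>0. \<exists>\<delta>>0. \<forall>h. norm h < \<delta> \<longrightarrow> x + h \<in> B \<longrightarrow> (\<forall>us. length us = i \<longrightarrow>
           \<bar>\<Phi> us (x + h) - \<Phi> us x - \<Phi>' (h # us) x\<bar> \<le> \<epsilon> * norm h * norms_prod us)))"

text \<open>
  The derivative is quantified existentially instead of being fixed as \<^const>\<open>iter_deriv\<close>. This way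
  the derivative of a composite can be named by one application of the chain rule, and higher
  derivatives are never written down.
\<close>

primrec smooth_forms ::
  "'a::real_normed_vector set \<Rightarrow> nat \<Rightarrow> nat \<Rightarrow> ('a list \<Rightarrow> 'a \<Rightarrow> real) \<Rightarrow> bool" where
  "smooth_forms B 0 = (\<lambda>i \<Phi>. bounded_continuous_forms B i \<Phi>)"
| "smooth_forms B (Suc m) = (\<lambda>i \<Phi>. bounded_continuous_forms B i \<Phi> \<and>
     (\<exists>\<Phi>'. forms_derivative B i \<Phi> \<Phi>' \<and> smooth_forms B m (Suc i) \<Phi>'))"

lemma norms_prod_nonneg: "0 \<le> norms_prod us"
  by (induction us) auto

text \<open>
  The bound can be taken positive, so that it may serve as a denominator.
\<close>

lemma bounded_continuous_formsD_bound:
  assumes "bounded_continuous_forms B i \<Phi>"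
  obtains C where "C > 0" "\<And>x us. x \<in> B \<Longrightarrow> length us = i \<Longrightarrow> \<bar>\<Phi> us x\<bar> \<le> C * norms_prod us"
proof -
  obtain C where C: "\<And>x us. x \<in> B \<Longrightarrow> length us = i \<Longrightarrow> \<bar>\<Phi> us x\<bar> \<le> C * norms_prod us"
    using assms unfolding bounded_continuous_forms_def by blast
  have "\<bar>\<Phi> us x\<bar> \<le> (\<bar>C\<bar> + 1) * norms_prod us" if "x \<in> B" "length us = i" for x us
    using C[OF that] norms_prod_nonneg[of us]
    by (smt (verit) mult_right_mono)
  then show ?thesis by (intro that[of "\<bar>C\<bar> + 1"]) auto
qed

lemma bounded_continuous_formsD_cont:
  assumes "bounded_continuous_forms B i \<Phi>" "x \<in> B" "\<epsilon> > 0"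
  obtains \<delta> where "\<delta> > 0" "\<And>y us. y \<in> B \<Longrightarrow> dist y x < \<delta> \<Longrightarrow> length us = i \<Longrightarrow>
    \<bar>\<Phi> us y - \<Phi> us x\<bar> \<le> \<epsilon> * norms_prod us"
  using assms unfolding bounded_continuous_forms_def by blast

lemma forms_derivativeD_linear:
  assumes "forms_derivative B i \<Phi> \<Phi>'" "x \<in> B" "length us = i"
  shows "linear (\<lambda>h. \<Phi>' (h # us) x)"
  using assms unfolding forms_derivative_def by blast

lemma forms_derivativeD_remainder:
  assumes "forms_derivative B i \<Phi> \<Phi>'" "x \<in> B" "\<epsilon> > 0"
  obtains \<delta> where "\<delta> > 0" "\<And>h us. norm h < \<delta> \<Longrightarrow> x + h \<in> B \<Longrightarrow> length us = i \<Longrightarrow>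
    \<bar>\<Phi> us (x + h) - \<Phi> us x - \<Phi>' (h # us) x\<bar> \<le> \<epsilon> * norm h * norms_prod us"
  using assms unfolding forms_derivative_def by meson

lemma smooth_forms_bounded_continuous:
  "smooth_forms B m i \<Phi> \<Longrightarrow> bounded_continuous_forms B i \<Phi>"
  by (cases m) auto

lemma smooth_forms_SucI:
  assumes "smooth_forms B m (Suc i) \<Phi>'" "forms_derivative B i \<Phi> \<Phi>'"
    and "bounded_continuous_forms B i \<Phi>"
  shows "smooth_forms B (Suc m) i \<Phi>"
  using assms by auto

lemma smooth_forms_Suc_imp: "smooth_forms B (Suc m) i \<Phi> \<Longrightarrow> smooth_forms B m i \<Phi>"
  by (induction m arbitrary: i \<Phi>) fastforce+

lemma bounded_continuous_forms_cong:
  assumes "\<And>us x. length us = i \<Longrightarrow> x \<in> B \<Longrightarrow> \<Phi> us x = \<Psi> us x"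
  shows "bounded_continuous_forms B i \<Phi> \<longleftrightarrow> bounded_continuous_forms B i \<Psi>"
  unfolding bounded_continuous_forms_def by (simp add: assms cong: ball_cong conj_cong imp_cong)

lemma forms_derivative_cong:
  assumes "\<And>us x. length us = i \<Longrightarrow> x \<in> B \<Longrightarrow> \<Phi> us x = \<Psi> us x"
    and "\<And>us x. length us = Suc i \<Longrightarrow> x \<in> B \<Longrightarrow> \<Phi>' us x = \<Psi>' us x"
  shows "forms_derivative B i \<Phi> \<Phi>' \<longleftrightarrow> forms_derivative B i \<Psi> \<Psi>'"
  unfolding forms_derivative_def by (simp add: assms cong: ball_cong conj_cong imp_cong)

lemma smooth_forms_cong:
  assumes "\<And>us x. length us = i \<Longrightarrow> x \<in> B \<Longrightarrow> \<Phi> us x = \<Psi> us x"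
  shows "smooth_forms B m i \<Phi> \<longleftrightarrow> smooth_forms B m i \<Psi>"
proof -
  have "bounded_continuous_forms B i \<Phi> \<longleftrightarrow> bounded_continuous_forms B i \<Psi>"
    by (rule bounded_continuous_forms_cong) (rule assms)
  moreover have "forms_derivative B i \<Phi> \<Phi>' \<longleftrightarrow> forms_derivative B i \<Psi> \<Phi>'" for \<Phi>'
    by (rule forms_derivative_cong) (simp_all add: assms)
  ultimately show ?thesis
    by (cases m) auto
qed

lemma smooth_forms_zero: "smooth_forms B m i (\<lambda>_ _. 0)"
proof -
  have "bounded_continuous_forms B i (\<lambda>_ _. 0)" for i
    unfolding bounded_continuous_forms_def
    by (auto intro!: exI[of _ 0] exI[of _ 1] mult_nonneg_nonneg norms_prod_nonneg)
  moreover have "forms_derivative B i (\<lambda>_ _. 0) (\<lambda>_ _. 0)" for i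
    unfolding forms_derivative_def
    by (auto intro!: exI[of _ 1] mult_nonneg_nonneg norms_prod_nonneg simp: linear_0 module_hom_zero)
  ultimately show ?thesis
    by (induction m arbitrary: i) auto
qed

lemma bounded_continuous_forms_add:
  assumes \<Phi>: "bounded_continuous_forms B i \<Phi>" and \<Psi>: "bounded_continuous_forms B i \<Psi>"
  shows "bounded_continuous_forms B i (\<lambda>us x. \<Phi> us x + \<Psi> us x)"
  unfolding bounded_continuous_forms_def
proof (intro conjI ballI allI impI)
  obtain C D where C: "\<And>x us. x \<in> B \<Longrightarrow> length us = i \<Longrightarrow> \<bar>\<Phi> us x\<bar> \<le> C * norms_prod us"
    and D: "\<And>x us. x \<in> B \<Longrightarrow> length us = i \<Longrightarrow> \<bar>\<Psi> us x\<bar> \<le> D * norms_prod us"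
    using \<Phi> \<Psi> by (metis bounded_continuous_formsD_bound)
  show "\<exists>C. \<forall>x\<in>B. \<forall>us. length us = i \<longrightarrow> \<bar>\<Phi> us x + \<Psi> us x\<bar> \<le> C * norms_prod us"
    using C D by (intro exI[of _ "C + D"]) (force simp: distrib_right intro: order_trans[OF abs_triangle_ineq])
next
  fix x and \<epsilon> :: real assume x: "x \<in> B" and e: "\<epsilon> > 0"
  obtain d1 where d1: "d1 > 0" "\<And>y us. y \<in> B \<Longrightarrow> dist y x < d1 \<Longrightarrow> length us = i \<Longrightarrow>
      \<bar>\<Phi> us y - \<Phi> us x\<bar> \<le> \<epsilon>/2 * norms_prod us"
    using bounded_continuous_formsD_cont[OF \<Phi> x, of "\<epsilon>/2"] e by auto
  obtain d2 where d2: "d2 > 0" "\<And>y us. y \<in> B \<Longrightarrow> dist y x < d2 \<Longrightarrow> length us = i \<Longrightarrow>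
      \<bar>\<Psi> us y - \<Psi> us x\<bar> \<le> \<epsilon>/2 * norms_prod us"
    using bounded_continuous_formsD_cont[OF \<Psi> x, of "\<epsilon>/2"] e by auto
  show "\<exists>\<delta>>0. \<forall>y\<in>B. dist y x < \<delta> \<longrightarrow> (\<forall>us. length us = i \<longrightarrow>
      \<bar>\<Phi> us y + \<Psi> us y - (\<Phi> us x + \<Psi> us x)\<bar> \<le> \<epsilon> * norms_prod us)"
  proof (intro exI[of _ "min d1 d2"] conjI ballI impI allI)
    fix y and us :: "'a list" assume "y \<in> B" "dist y x < min d1 d2" "length us = i"
    then show "\<bar>\<Phi> us y + \<Psi> us y - (\<Phi> us x + \<Psi> us x)\<bar> \<le> \<epsilon> * norms_prod us"
      using d1(2)[of y us] d2(2)[of y us] by (simp; linarith)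
  qed (use d1 d2 in auto)
qed

lemma forms_derivative_add:
  assumes \<Phi>: "forms_derivative B i \<Phi> \<Phi>'" and \<Psi>: "forms_derivative B i \<Psi> \<Psi>'"
  shows "forms_derivative B i (\<lambda>us x. \<Phi> us x + \<Psi> us x) (\<lambda>us x. \<Phi>' us x + \<Psi>' us x)"
  unfolding forms_derivative_def
proof (intro conjI ballI allI impI)
  fix x :: 'a and us :: "'a list" assume "x \<in> B" "length us = i"
  then show "linear (\<lambda>h. \<Phi>' (h # us) x + \<Psi>' (h # us) x)"
    using assms by (intro linear_compose_add forms_derivativeD_linear)
next
  fix x and \<epsilon> :: real assume x: "x \<in> B" and e: "\<epsilon> > 0"
  obtain d1 where d1: "d1 > 0" "\<And>h us. norm h < d1 \<Longrightarrow> x + h \<in> B \<Longrightarrow> length us = i \<Longrightarrow>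
    \<bar>\<Phi> us (x + h) - \<Phi> us x - \<Phi>' (h # us) x\<bar> \<le> \<epsilon>/2 * norm h * norms_prod us"
    using forms_derivativeD_remainder[OF \<Phi> x, of "\<epsilon>/2"] e by auto
  obtain d2 where d2: "d2 > 0" "\<And>h us. norm h < d2 \<Longrightarrow> x + h \<in> B \<Longrightarrow> length us = i \<Longrightarrow>
    \<bar>\<Psi> us (x + h) - \<Psi> us x - \<Psi>' (h # us) x\<bar> \<le> \<epsilon>/2 * norm h * norms_prod us"
    using forms_derivativeD_remainder[OF \<Psi> x, of "\<epsilon>/2"] e by auto
  show "\<exists>\<delta>>0. \<forall>h. norm h < \<delta> \<longrightarrow> x + h \<in> B \<longrightarrow> (\<forall>us. length us = i \<longrightarrow>
     \<bar>\<Phi> us (x + h) + \<Psi> us (x + h) - (\<Phi> us x + \<Psi> us x) - (\<Phi>' (h # us) x + \<Psi>' (h # us) x)\<bar>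
       \<le> \<epsilon> * norm h * norms_prod us)"
  proof (intro exI[of _ "min d1 d2"] conjI ballI impI allI)
    fix h and us :: "'a list" assume "norm h < min d1 d2" "x + h \<in> B" "length us = i"
    then show "\<bar>\<Phi> us (x + h) + \<Psi> us (x + h) - (\<Phi> us x + \<Psi> us x) - (\<Phi>' (h # us) x + \<Psi>' (h # us) x)\<bar>
       \<le> \<epsilon> * norm h * norms_prod us"
      using d1(2)[of h us] d2(2)[of h us] by (simp; linarith)
  qed (use d1 d2 in auto)
qed

lemma smooth_forms_add:
  assumes "smooth_forms B m i \<Phi>" "smooth_forms B m i \<Psi>"
  shows "smooth_forms B m i (\<lambda>us x. \<Phi> us x + \<Psi> us x)"
  using assms
proof (induction m arbitrary: i \<Phi> \<Psi>)
  case 0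
  then show ?case by (simp add: bounded_continuous_forms_add)
next
  case (Suc m)
  obtain \<Phi>' \<Psi>' where "forms_derivative B i \<Phi> \<Phi>'" "smooth_forms B m (Suc i) \<Phi>'"
    "forms_derivative B i \<Psi> \<Psi>'" "smooth_forms B m (Suc i) \<Psi>'"
    using Suc.prems by auto
  moreover note Suc.prems[THEN smooth_forms_bounded_continuous]
  ultimately show ?case
    by (intro smooth_forms_SucI[OF Suc.IH forms_derivative_add bounded_continuous_forms_add])
qed

text \<open>
  A product of forms distributes the directions over its two factors. The selections \<open>\<sigma>\<close> and \<open>\<tau>\<close> say
  how; they are arbitrary because differentiating the product adds the new direction to one of the
  two sides, and the summands of the derivative are then products of the same kind.
\<close>

lemma bounded_continuous_forms_mult:
  assumes \<Phi>: "bounded_continuous_forms B i \<Phi>" and \<Psi>: "bounded_continuous_forms B j \<Psi>"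
    and sel: "\<And>us. length us = n \<Longrightarrow> length (\<sigma> us) = i \<and> length (\<tau> us) = j \<and>
      norms_prod (\<sigma> us) * norms_prod (\<tau> us) = norms_prod us"
  shows "bounded_continuous_forms B n (\<lambda>us x. \<Phi> (\<sigma> us) x * \<Psi> (\<tau> us) x)"
  unfolding bounded_continuous_forms_def
proof (intro conjI ballI allI impI)
  obtain C where C: "C > 0" "\<And>x us. x \<in> B \<Longrightarrow> length us = i \<Longrightarrow> \<bar>\<Phi> us x\<bar> \<le> C * norms_prod us"
    by (rule bounded_continuous_formsD_bound[OF \<Phi>]) (rule that)
  obtain D where D: "D > 0" "\<And>x us. x \<in> B \<Longrightarrow> length us = j \<Longrightarrow> \<bar>\<Psi> us x\<bar> \<le> D * norms_prod us"
    by (rule bounded_continuous_formsD_bound[OF \<Psi>]) (rule that)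
  have "\<bar>\<Phi> (\<sigma> us) x * \<Psi> (\<tau> us) x\<bar> \<le> C * D * norms_prod us" if "x \<in> B" "length us = n" for x us
  proof -
    have "\<bar>\<Phi> (\<sigma> us) x * \<Psi> (\<tau> us) x\<bar> \<le> (C * norms_prod (\<sigma> us)) * (D * norms_prod (\<tau> us))"
      unfolding abs_mult using C(2)[OF that(1)] D(2)[OF that(1)] sel[OF that(2)] C(1)
      by (intro mult_mono) (auto intro!: mult_nonneg_nonneg norms_prod_nonneg)
    then show ?thesis using sel[OF that(2)] by (metis mult.assoc mult.left_commute)
  qed
  then show "\<exists>C. \<forall>x\<in>B. \<forall>us. length us = n \<longrightarrow> \<bar>\<Phi> (\<sigma> us) x * \<Psi> (\<tau> us) x\<bar> \<le> C * norms_prod us"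
    by blast
  fix x and \<epsilon> :: real assume x: "x \<in> B" and e: "\<epsilon> > 0"
  \<comment> \<open>The two summands below contribute \<open>D\<close> and \<open>C\<close> times the modulus of continuity of one factor.\<close>
  define e' where "e' = \<epsilon> / (C + D)"
  have e': "e' > 0" "\<epsilon> = e' * (C + D)" using C(1) D(1) e by (auto simp: e'_def)
  obtain d1 where d1: "d1 > 0" "\<And>y us. y \<in> B \<Longrightarrow> dist y x < d1 \<Longrightarrow> length us = i \<Longrightarrow>
      \<bar>\<Phi> us y - \<Phi> us x\<bar> \<le> e' * norms_prod us"
    by (rule bounded_continuous_formsD_cont[OF \<Phi> x e'(1)]) (rule that)
  obtain d2 where d2: "d2 > 0" "\<And>y us. y \<in> B \<Longrightarrow> dist y x < d2 \<Longrightarrow> length us = j \<Longrightarrow>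
      \<bar>\<Psi> us y - \<Psi> us x\<bar> \<le> e' * norms_prod us"
    by (rule bounded_continuous_formsD_cont[OF \<Psi> x e'(1)]) (rule that)
  show "\<exists>\<delta>>0. \<forall>y\<in>B. dist y x < \<delta> \<longrightarrow> (\<forall>us. length us = n \<longrightarrow>
      \<bar>\<Phi> (\<sigma> us) y * \<Psi> (\<tau> us) y - \<Phi> (\<sigma> us) x * \<Psi> (\<tau> us) x\<bar> \<le> \<epsilon> * norms_prod us)"
  proof (intro exI[of _ "min d1 d2"] conjI ballI impI allI)
    fix y and us :: "'a list" assume y: "y \<in> B" "dist y x < min d1 d2" and us: "length us = n"
    define p q where "p = norms_prod (\<sigma> us)" and "q = norms_prod (\<tau> us)"
    have pq: "p \<ge> 0" "q \<ge> 0" "p * q = norms_prod us"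
      using sel[OF us] by (auto simp: p_def q_def norms_prod_nonneg)
    have eq: "\<Phi> (\<sigma> us) y * \<Psi> (\<tau> us) y - \<Phi> (\<sigma> us) x * \<Psi> (\<tau> us) x
        = (\<Phi> (\<sigma> us) y - \<Phi> (\<sigma> us) x) * \<Psi> (\<tau> us) y + \<Phi> (\<sigma> us) x * (\<Psi> (\<tau> us) y - \<Psi> (\<tau> us) x)"
      by algebra
    have "\<bar>(\<Phi> (\<sigma> us) y - \<Phi> (\<sigma> us) x) * \<Psi> (\<tau> us) y + \<Phi> (\<sigma> us) x * (\<Psi> (\<tau> us) y - \<Psi> (\<tau> us) x)\<bar> \<le> (e' * p) * (D * q) + (C * p) * (e' * q)"
      using C D d1 d2 e' x y sel[OF us] pq unfolding p_def q_def
      by (intro order_trans[OF abs_triangle_ineq] add_mono) (auto simp: abs_mult intro!: mult_mono)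
    also have "\<dots> = \<epsilon> * norms_prod us"
      unfolding e'(2) pq(3)[symmetric] by algebra
    finally show "\<bar>\<Phi> (\<sigma> us) y * \<Psi> (\<tau> us) y - \<Phi> (\<sigma> us) x * \<Psi> (\<tau> us) x\<bar> \<le> \<epsilon> * norms_prod us"
      unfolding eq .
  qed (use d1 d2 in auto)
qed

lemma forms_derivative_mult:
  assumes \<Phi>: "forms_derivative B i \<Phi> \<Phi>'" and \<Psi>: "forms_derivative B j \<Psi> \<Psi>'"
    and bc: "bounded_continuous_forms B i \<Phi>" "bounded_continuous_forms B j \<Psi>"
      "bounded_continuous_forms B (Suc i) \<Phi>'"
    and sel: "\<And>us. length us = n \<Longrightarrow> length (\<sigma> us) = i \<and> length (\<tau> us) = j \<and>
      norms_prod (\<sigma> us) * norms_prod (\<tau> us) = norms_prod us"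
  shows "forms_derivative B n (\<lambda>us x. \<Phi> (\<sigma> us) x * \<Psi> (\<tau> us) x)
    (\<lambda>us x. \<Phi>' (hd us # \<sigma> (tl us)) x * \<Psi> (\<tau> (tl us)) x + \<Phi> (\<sigma> (tl us)) x * \<Psi>' (hd us # \<tau> (tl us)) x)"
  unfolding forms_derivative_def list.sel
proof (intro conjI ballI allI impI)
  fix x :: 'a and us :: "'a list" assume x: "x \<in> B" "length us = n"
  have "linear (\<lambda>h. \<Phi>' (h # \<sigma> us) x)" "linear (\<lambda>h. \<Psi>' (h # \<tau> us) x)"
    using forms_derivativeD_linear[OF \<Phi>] forms_derivativeD_linear[OF \<Psi>] x sel by blast+
  then show "linear (\<lambda>h. \<Phi>' (h # \<sigma> us) x * \<Psi> (\<tau> us) x + \<Phi> (\<sigma> us) x * \<Psi>' (h # \<tau> us) x)"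
    by (auto simp: linear_iff algebra_simps)
next
  fix x and \<epsilon> :: real assume x: "x \<in> B" and e: "\<epsilon> > 0"
  obtain C where C: "C > 0" "\<And>x us. x \<in> B \<Longrightarrow> length us = i \<Longrightarrow> \<bar>\<Phi> us x\<bar> \<le> C * norms_prod us"
    by (rule bounded_continuous_formsD_bound[OF bc(1)]) (rule that)
  obtain D where D: "D > 0" "\<And>x us. x \<in> B \<Longrightarrow> length us = j \<Longrightarrow> \<bar>\<Psi> us x\<bar> \<le> D * norms_prod us"
    by (rule bounded_continuous_formsD_bound[OF bc(2)]) (rule that)
  obtain E where E: "E > 0" "\<And>x us. x \<in> B \<Longrightarrow> length us = Suc i \<Longrightarrow> \<bar>\<Phi>' us x\<bar> \<le> E * norms_prod us"
    by (rule bounded_continuous_formsD_bound[OF bc(3)]) (rule that)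
  \<comment> \<open>The remainder of the product splits into the remainder of either factor, with weights \<open>D\<close> and
    \<open>C\<close>, and a mixed term, with weight \<open>E\<close>.\<close>
  define e' where "e' = \<epsilon> / (C + D + E)"
  have e': "e' > 0" "\<epsilon> = e' * (C + D + E)" using C(1) D(1) E(1) e by (auto simp: e'_def)
  obtain d1 where d1: "d1 > 0" "\<And>h us. norm h < d1 \<Longrightarrow> x + h \<in> B \<Longrightarrow> length us = i \<Longrightarrow>
    \<bar>\<Phi> us (x + h) - \<Phi> us x - \<Phi>' (h # us) x\<bar> \<le> e' * norm h * norms_prod us"
    by (rule forms_derivativeD_remainder[OF \<Phi> x e'(1)]) (rule that)
  obtain d2 where d2: "d2 > 0" "\<And>h us. norm h < d2 \<Longrightarrow> x + h \<in> B \<Longrightarrow> length us = j \<Longrightarrow>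
    \<bar>\<Psi> us (x + h) - \<Psi> us x - \<Psi>' (h # us) x\<bar> \<le> e' * norm h * norms_prod us"
    by (rule forms_derivativeD_remainder[OF \<Psi> x e'(1)]) (rule that)
  obtain d3 where d3: "d3 > 0" "\<And>y us. y \<in> B \<Longrightarrow> dist y x < d3 \<Longrightarrow> length us = j \<Longrightarrow>
      \<bar>\<Psi> us y - \<Psi> us x\<bar> \<le> e' * norms_prod us"
    by (rule bounded_continuous_formsD_cont[OF bc(2) x e'(1)]) (rule that)
  show "\<exists>\<delta>>0. \<forall>h. norm h < \<delta> \<longrightarrow> x + h \<in> B \<longrightarrow> (\<forall>us. length us = n \<longrightarrow>
     \<bar>\<Phi> (\<sigma> us) (x + h) * \<Psi> (\<tau> us) (x + h) - \<Phi> (\<sigma> us) x * \<Psi> (\<tau> us) x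
       - (\<Phi>' (h # \<sigma> us) x * \<Psi> (\<tau> us) x + \<Phi> (\<sigma> us) x * \<Psi>' (h # \<tau> us) x)\<bar>
       \<le> \<epsilon> * norm h * norms_prod us)"
  proof (intro exI[of _ "min d1 (min d2 d3)"] conjI ballI impI allI)
    fix h and us :: "'a list"
    assume h: "norm h < min d1 (min d2 d3)" "x + h \<in> B" and us: "length us = n"
    define p q where "p = norms_prod (\<sigma> us)" and "q = norms_prod (\<tau> us)"
    have pq: "p \<ge> 0" "q \<ge> 0" "p * q = norms_prod us"
      using sel[OF us] by (auto simp: p_def q_def norms_prod_nonneg)
    have E': "\<bar>\<Phi>' (h # \<sigma> us) x\<bar> \<le> E * norm h * p"
      using E(2)[OF x, of "h # \<sigma> us"] sel[OF us] by (simp add: p_def mult.assoc)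
    have len: "length (\<sigma> us) = i" "length (\<tau> us) = j" using sel[OF us] by auto
    have hh: "norm h < d1" "norm h < d2" "dist (x + h) x < d3" using h by (auto simp: dist_norm)
    have eq: "\<Phi> (\<sigma> us) (x + h) * \<Psi> (\<tau> us) (x + h) - \<Phi> (\<sigma> us) x * \<Psi> (\<tau> us) x
       - (\<Phi>' (h # \<sigma> us) x * \<Psi> (\<tau> us) x + \<Phi> (\<sigma> us) x * \<Psi>' (h # \<tau> us) x)
       = (\<Phi> (\<sigma> us) (x + h) - \<Phi> (\<sigma> us) x - \<Phi>' (h # \<sigma> us) x) * \<Psi> (\<tau> us) (x + h)
       + \<Phi> (\<sigma> us) x * (\<Psi> (\<tau> us) (x + h) - \<Psi> (\<tau> us) x - \<Psi>' (h # \<tau> us) x)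
       + \<Phi>' (h # \<sigma> us) x * (\<Psi> (\<tau> us) (x + h) - \<Psi> (\<tau> us) x)"
      (is "_ = ?a * ?b + ?c * ?d + ?e * ?f")
      by (simp add: algebra_simps)
    have "\<bar>?a * ?b + ?c * ?d + ?e * ?f\<bar> \<le> \<bar>?a * ?b\<bar> + \<bar>?c * ?d\<bar> + \<bar>?e * ?f\<bar>"
      by (rule order_trans[OF abs_triangle_ineq add_right_mono[OF abs_triangle_ineq]])
    also have "\<dots> \<le> (e' * norm h * p) * (D * q) + (C * p) * (e' * norm h * q) + (E * norm h * p) * (e' * q)"
    proof (intro add_mono)
      show "\<bar>?a * ?b\<bar> \<le> (e' * norm h * p) * (D * q)"
        unfolding abs_mult p_def q_def
        by (rule mult_mono[OF d1(2)[OF hh(1) h(2) len(1)] D(2)[OF h(2) len(2)]])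
          (simp_all add: e'(1) less_imp_le norms_prod_nonneg)
      show "\<bar>?c * ?d\<bar> \<le> (C * p) * (e' * norm h * q)"
        unfolding abs_mult p_def q_def
        by (rule mult_mono[OF C(2)[OF x len(1)] d2(2)[OF hh(2) h(2) len(2)]])
          (simp_all add: C(1) less_imp_le norms_prod_nonneg)
      show "\<bar>?e * ?f\<bar> \<le> (E * norm h * p) * (e' * q)"
        unfolding abs_mult q_def
        by (rule mult_mono[OF E' d3(2)[OF h(2) hh(3) len(2)]])
          (simp_all add: E(1) less_imp_le pq(1))
    qed
    also have "\<dots> = \<epsilon> * norm h * norms_prod us"
      unfolding e'(2) pq(3)[symmetric] by (simp add: algebra_simps)
    finally show "\<bar>\<Phi> (\<sigma> us) (x + h) * \<Psi> (\<tau> us) (x + h) - \<Phi> (\<sigma> us) x * \<Psi> (\<tau> us) x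
       - (\<Phi>' (h # \<sigma> us) x * \<Psi> (\<tau> us) x + \<Phi> (\<sigma> us) x * \<Psi>' (h # \<tau> us) x)\<bar>
       \<le> \<epsilon> * norm h * norms_prod us"
      unfolding eq .
  qed (use d1 d2 d3 in auto)
qed

text \<open>
  The Leibniz rule keeps the shape of the product, so the induction on the order closes without any
  sum over the ways of splitting the directions.
\<close>

lemma smooth_forms_mult:
  assumes "smooth_forms B m i \<Phi>" "smooth_forms B m j \<Psi>"
    and "\<And>us. length us = n \<Longrightarrow> length (\<sigma> us) = i \<and> length (\<tau> us) = j \<and>
      norms_prod (\<sigma> us) * norms_prod (\<tau> us) = norms_prod us"
  shows "smooth_forms B m n (\<lambda>us x. \<Phi> (\<sigma> us) x * \<Psi> (\<tau> us) x)"
  using assms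
proof (induction m arbitrary: i j n \<Phi> \<Psi> \<sigma> \<tau>)
  case 0
  then show ?case by (simp add: bounded_continuous_forms_mult)
next
  case (Suc m)
  obtain \<Phi>' where \<Phi>': "forms_derivative B i \<Phi> \<Phi>'" "smooth_forms B m (Suc i) \<Phi>'"
    using Suc.prems(1) by auto
  obtain \<Psi>' where \<Psi>': "forms_derivative B j \<Psi> \<Psi>'" "smooth_forms B m (Suc j) \<Psi>'"
    using Suc.prems(2) by auto
  note bc = smooth_forms_bounded_continuous[OF Suc.prems(1)] smooth_forms_bounded_continuous[OF Suc.prems(2)]
  note low = smooth_forms_Suc_imp[OF Suc.prems(1)] smooth_forms_Suc_imp[OF Suc.prems(2)]
  have sel: "length (\<sigma> (tl us)) = i \<and> length (\<tau> (tl us)) = j \<and>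
      norms_prod (\<sigma> (tl us)) * norms_prod (\<tau> (tl us)) = norms_prod (tl us)"
     "norms_prod us = norm (hd us) * norms_prod (tl us)" if "length us = Suc n" for us
    using Suc.prems(3)[of "tl us"] that by (cases us; simp)+
  have "smooth_forms B m (Suc n) (\<lambda>us x. \<Phi>' (hd us # \<sigma> (tl us)) x * \<Psi> (\<tau> (tl us)) x)"
    using sel by (intro Suc.IH[OF \<Phi>'(2) low(2)]) (auto simp: mult.assoc)
  moreover have "smooth_forms B m (Suc n) (\<lambda>us x. \<Phi> (\<sigma> (tl us)) x * \<Psi>' (hd us # \<tau> (tl us)) x)"
    using sel by (intro Suc.IH[OF low(1) \<Psi>'(2)]) (auto simp: mult.left_commute)
  ultimately have "smooth_forms B m (Suc n) (\<lambda>us x.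
      \<Phi>' (hd us # \<sigma> (tl us)) x * \<Psi> (\<tau> (tl us)) x + \<Phi> (\<sigma> (tl us)) x * \<Psi>' (hd us # \<tau> (tl us)) x)"
    by (rule smooth_forms_add)
  moreover have "forms_derivative B n (\<lambda>us x. \<Phi> (\<sigma> us) x * \<Psi> (\<tau> us) x) (\<lambda>us x.
      \<Phi>' (hd us # \<sigma> (tl us)) x * \<Psi> (\<tau> (tl us)) x + \<Phi> (\<sigma> (tl us)) x * \<Psi>' (hd us # \<tau> (tl us)) x)"
    using \<Phi>'(1) \<Psi>'(1) bc smooth_forms_bounded_continuous[OF \<Phi>'(2)]
    by (rule forms_derivative_mult) (rule Suc.prems(3))
  moreover have "bounded_continuous_forms B n (\<lambda>us x. \<Phi> (\<sigma> us) x * \<Psi> (\<tau> us) x)"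
    using bc by (rule bounded_continuous_forms_mult) (rule Suc.prems(3))
  ultimately show ?case
    by (rule smooth_forms_SucI)
qed

lemma bounded_continuous_forms_0_iff:
  "bounded_continuous_forms B 0 (\<lambda>_. g) \<longleftrightarrow> bounded (g ` B) \<and> continuous_on B g"
  unfolding bounded_continuous_forms_def continuous_on_iff bounded_iff
  apply (auto simp: dist_real_def)
   apply (meson dense order_le_less_trans)
  by (meson less_imp_le)

lemma forms_derivative_imp_has_derivative:
  assumes "open B" "forms_derivative B i \<Phi> \<Phi>'" "bounded_continuous_forms B (Suc i) \<Phi>'"
    and x: "x \<in> B" and us: "length us = i"
  shows "(\<Phi> us has_derivative (\<lambda>h. \<Phi>' (h # us) x)) (at x)"
  unfolding has_derivative_at_alt
proof (intro conjI allI impI)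
  obtain C where C: "C > 0" "\<And>x us. x \<in> B \<Longrightarrow> length us = Suc i \<Longrightarrow> \<bar>\<Phi>' us x\<bar> \<le> C * norms_prod us"
    by (rule bounded_continuous_formsD_bound[OF assms(3)]) (rule that)
  have "norm (\<Phi>' (h # us) x) \<le> norm h * (C * norms_prod us)" for h
    using C(2)[OF x, of "h # us"] us by (simp add: mult_ac)
  then show "bounded_linear (\<lambda>h. \<Phi>' (h # us) x)"
    using forms_derivativeD_linear[OF assms(2) x us]
    by (intro bounded_linear.intro bounded_linear_axioms.intro) auto
  fix e :: real assume e: "e > 0"
  define e' where "e' = e / (norms_prod us + 1)"
  have pos: "norms_prod us + 1 > 0" using norms_prod_nonneg[of us] by linarith
  then have e': "e' > 0" using e by (simp add: e'_def)
  have e'': "e' * norms_prod us \<le> e"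
    using e pos by (simp add: e'_def pos_divide_le_eq)
  obtain d1 where d1: "d1 > 0" "\<And>h us. norm h < d1 \<Longrightarrow> x + h \<in> B \<Longrightarrow> length us = i \<Longrightarrow>
    \<bar>\<Phi> us (x + h) - \<Phi> us x - \<Phi>' (h # us) x\<bar> \<le> e' * norm h * norms_prod us"
    by (rule forms_derivativeD_remainder[OF assms(2) x e'(1)]) (rule that)
  obtain d2 where d2: "d2 > 0" "\<And>y. dist y x < d2 \<Longrightarrow> y \<in> B"
    using \<open>open B\<close> x unfolding open_dist by blast
  show "\<exists>d>0. \<forall>y. norm (y - x) < d \<longrightarrow>
      norm (\<Phi> us y - \<Phi> us x - \<Phi>' ((y - x) # us) x) \<le> e * norm (y - x)"
  proof (intro exI[of _ "min d1 d2"] conjI allI impI)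
    fix y assume y: "norm (y - x) < min d1 d2"
    then have "norm (\<Phi> us y - \<Phi> us x - \<Phi>' ((y - x) # us) x) \<le> e' * norm (y - x) * norms_prod us"
      using d1(2)[of "y - x" us] d2(2)[of y] us by (simp add: dist_norm)
    also have "\<dots> \<le> e * norm (y - x)"
      using mult_right_mono[OF e'', of "norm (y - x)"] by (simp add: mult_ac)
    finally show "norm (\<Phi> us y - \<Phi> us x - \<Phi>' ((y - x) # us) x) \<le> e * norm (y - x)" .
  qed (use d1 d2 in auto)
qed

text \<open>
  A family of degree \<open>0\<close> is a scalar function, and its derivative is the usual one.
\<close>

lemma forms_derivative_0I:
  assumes "\<And>x. x \<in> B \<Longrightarrow> (g has_derivative (\<lambda>h. \<Phi>' [h] x)) (at x)"
  shows "forms_derivative B 0 (\<lambda>_. g) \<Phi>'"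
  unfolding forms_derivative_def
proof (intro ballI conjI allI impI)
  fix x :: 'a and us :: "'a list" assume "x \<in> B" "length us = 0"
  then show "linear (\<lambda>h. \<Phi>' (h # us) x)"
    using assms has_derivative_linear by auto
next
  fix x and e :: real assume x: "x \<in> B" and e: "e > 0"
  obtain d where d: "d > 0" "\<And>y. norm (y - x) < d \<Longrightarrow> norm (g y - g x - \<Phi>' [y - x] x) \<le> e * norm (y - x)"
    using assms[OF x] e unfolding has_derivative_at_alt by meson
  show "\<exists>\<delta>>0. \<forall>h. norm h < \<delta> \<longrightarrow> x + h \<in> B \<longrightarrow> (\<forall>us. length us = 0 \<longrightarrow>
      \<bar>g (x + h) - g x - \<Phi>' (h # us) x\<bar> \<le> e * norm h * norms_prod us)"
    using d(1) d(2)[of "x + _"] by (intro exI[of _ d]) auto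
qed

text \<open>
  \<open>f n\<close> stands for the \<open>n\<close>-th derivative of \<open>f 0\<close>. The derivative of \<open>f n \<circ> a\<close> is the product of
  \<open>f (n + 1) \<circ> a\<close>, smooth of one order less by induction, with the derivative of \<open>a\<close>. This replaces
  the formula of Faa di Bruno.
\<close>

lemma smooth_forms_compose:
  fixes f :: "nat \<Rightarrow> real \<Rightarrow> real"
  assumes "open B" and "smooth_forms B m 0 (\<lambda>_. a)"
    and K: "compact K" "a ` B \<subseteq> K"
    and f: "\<And>n t. t \<in> K \<Longrightarrow> (f n has_real_derivative f (Suc n) t) (at t)"
  shows "smooth_forms B m 0 (\<lambda>_ x. f n (a x))"
  using assms(2)
proof (induction m arbitrary: n)
  case 0
  have "continuous_on K (f n)" for n
    using f by (meson continuous_at_imp_continuous_on DERIV_isCont)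
  then have "bounded (f n ` K)" for n
    using K(1) compact_continuous_image compact_imp_bounded by blast
  then have b: "bounded ((\<lambda>x. f n (a x)) ` B)"
    using K(2) by (metis bounded_subset image_image image_mono)
  have "continuous_on B a" using 0 by (simp add: bounded_continuous_forms_0_iff)
  then have "continuous_on B (\<lambda>x. f n (a x))"
    by (rule continuous_on_compose2[OF \<open>continuous_on K (f n)\<close> _ K(2)])
  with b show ?case by (simp add: bounded_continuous_forms_0_iff)
next
  case (Suc m)
  obtain \<Phi>' where \<Phi>': "forms_derivative B 0 (\<lambda>_. a) \<Phi>'" "smooth_forms B m (Suc 0) \<Phi>'"
    using Suc.prems by auto
  have IH: "smooth_forms B m 0 (\<lambda>_ x. f n (a x))" for n
    using Suc.IH smooth_forms_Suc_imp[OF Suc.prems] .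
  have "smooth_forms B m (Suc 0) (\<lambda>us x. f (Suc n) (a x) * \<Phi>' us x)"
    using smooth_forms_mult[OF IH \<Phi>'(2), of "Suc 0" "\<lambda>_. []" "\<lambda>us. us" "Suc n"] by simp
  moreover have "forms_derivative B 0 (\<lambda>_ x. f n (a x)) (\<lambda>us x. f (Suc n) (a x) * \<Phi>' us x)"
  proof (rule forms_derivative_0I)
    fix x assume x: "x \<in> B"
    have "(a has_derivative (\<lambda>h. \<Phi>' [h] x)) (at x)"
      using forms_derivative_imp_has_derivative[OF \<open>open B\<close> \<Phi>'(1)
          smooth_forms_bounded_continuous[OF \<Phi>'(2)] x, of "[]"] by simp
    moreover have "(f n has_derivative (\<lambda>t. f (Suc n) (a x) * t)) (at (a x))"
      using f[of "a x" n] x K(2) by (auto simp: has_field_derivative_def)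
    ultimately show "((\<lambda>x. f n (a x)) has_derivative (\<lambda>h. f (Suc n) (a x) * \<Phi>' [h] x)) (at x)"
      using has_derivative_compose by blast
  qed
  ultimately show ?case
    by (rule smooth_forms_SucI) (rule smooth_forms_bounded_continuous[OF IH])
qed

section \<open>Multilinear forms and their norm\<close>

lemma mult_formsD:
  assumes "T \<in> mult_forms i"
  shows "length us \<noteq> i \<Longrightarrow> T us = 0"
    and "length us = i \<Longrightarrow> j < i \<Longrightarrow> linear (\<lambda>v. T (us[j := v]))"
    and "\<exists>C. \<forall>us. length us = i \<longrightarrow> \<bar>T us\<bar> \<le> C * norms_prod us"
  using assms unfolding mult_forms_def by blast+

lemma mult_forms_diff:
  assumes S: "S \<in> mult_forms i" and T: "T \<in> mult_forms i"
  shows "S - T \<in> mult_forms i"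
  unfolding mult_forms_def mem_Collect_eq
proof (intro conjI allI impI)
  fix us :: "'a list" assume "length us \<noteq> i"
  then show "(S - T) us = 0" using mult_formsD(1)[OF S] mult_formsD(1)[OF T] by simp
next
  fix us :: "'a list" and j assume "length us = i" "j < i"
  then show "linear (\<lambda>v. (S - T) (us[j := v]))"
    using mult_formsD(2)[OF S] mult_formsD(2)[OF T] by (simp add: linear_compose_sub)
next
  obtain C D where C: "\<And>us. length us = i \<Longrightarrow> \<bar>S us\<bar> \<le> C * norms_prod us"
    and D: "\<And>us. length us = i \<Longrightarrow> \<bar>T us\<bar> \<le> D * norms_prod us"
    using mult_formsD(3)[OF S] mult_formsD(3)[OF T] by blast
  have "\<bar>(S - T) us\<bar> \<le> (C + D) * norms_prod us" if "length us = i" for us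
    using C[OF that] D[OF that] by (simp add: distrib_right)
  then show "\<exists>C. \<forall>us. length us = i \<longrightarrow> \<bar>(S - T) us\<bar> \<le> C * norms_prod us" by blast
qed

lemma norms_prod_le_1: "(\<forall>u\<in>set us. norm u \<le> 1) \<Longrightarrow> norms_prod us \<le> 1"
  by (induction us) (auto intro!: mult_le_one norms_prod_nonneg)

lemma mult_norm_leI:
  assumes "\<And>us. length us = i \<Longrightarrow> \<bar>T us\<bar> \<le> c * norms_prod us" and "0 \<le> c"
  shows "mult_norm i T \<le> c"
  unfolding mult_norm_def
proof (rule cSUP_least)
  show "{us :: 'a list. length us = i \<and> (\<forall>u\<in>set us. norm u \<le> 1)} \<noteq> {}"
    by (auto intro!: exI[of _ "replicate i 0"])
  fix us :: "'a list" assume "us \<in> {us. length us = i \<and> (\<forall>u\<in>set us. norm u \<le> 1)}"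
  then have us: "length us = i" "norms_prod us \<le> 1" using norms_prod_le_1 by auto
  have "\<bar>T us\<bar> \<le> c * norms_prod us" using assms(1)[OF us(1)] .
  also have "\<dots> \<le> c" using us(2) assms(2) by (simp add: mult_left_le)
  finally show "\<bar>T us\<bar> \<le> c" .
qed

lemma abs_le_mult_norm:
  assumes T: "T \<in> mult_forms i" and us: "length us = i" "\<forall>u\<in>set us. norm u \<le> 1"
  shows "\<bar>T us\<bar> \<le> mult_norm i T"
proof -
  obtain C where C: "\<And>us. length us = i \<Longrightarrow> \<bar>T us\<bar> \<le> C * norms_prod us"
    using mult_formsD(3)[OF T] by blast
  have "\<bar>T us\<bar> \<le> \<bar>C\<bar>" if "length us = i" "\<forall>u\<in>set us. norm u \<le> 1" for us
  proof -
    have "\<bar>T us\<bar> \<le> C * norms_prod us" using C that(1) .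
    also have "\<dots> \<le> \<bar>C\<bar> * 1"
      using norms_prod_le_1[OF that(2)] by (intro mult_mono norms_prod_nonneg) auto
    finally show ?thesis by simp
  qed
  then have "bdd_above ((\<lambda>us. \<bar>T us\<bar>) ` {us. length us = i \<and> (\<forall>u\<in>set us. norm u \<le> 1)})"
    by (intro bdd_aboveI2[of _ _ "\<bar>C\<bar>"]) auto
  then show ?thesis
    unfolding mult_norm_def using us by (intro cSUP_upper) auto
qed

lemma mult_norm_nonneg: "T \<in> mult_forms i \<Longrightarrow> 0 \<le> mult_norm i T"
  using abs_le_mult_norm[of T i "replicate i 0"] by simp

text \<open>
  Every argument is replaced by its direction \<open>sgn u = u / norm u\<close>, one slot at a time. Since
  \<open>u = norm u *\<^sub>R sgn u\<close> holds for \<open>u = 0\<close> as well, zero vectors need no separate treatment.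
\<close>

lemma mult_forms_eq_sgn:
  assumes T: "T \<in> mult_forms i" and us: "length us = i"
  shows "T us = norms_prod us * T (map sgn us)"
proof -
  have "T us = norms_prod (take j us) * T (map sgn (take j us) @ drop j us)" if "j \<le> i" for j
    using that
  proof (induction j)
    case 0
    then show ?case by simp
  next
    case (Suc j)
    then have j: "j < i" by simp
    define ws where "ws = map sgn (take j us) @ drop j us"
    have ws: "length ws = i" "ws ! j = us ! j" using us j by (auto simp: ws_def nth_append)
    have upd: "map sgn (take (Suc j) us) @ drop (Suc j) us = ws[j := sgn (us ! j)]"
      using us j by (simp add: ws_def take_Suc_conv_app_nth list_update_append Cons_nth_drop_Suc[symmetric])
    have "T ws = T (ws[j := norm (us ! j) *\<^sub>R sgn (us ! j)])"
    proof -
      have "norm (us ! j) *\<^sub>R sgn (us ! j) = ws ! j"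
        unfolding ws(2) by (cases "us ! j = 0") (simp_all add: sgn_div_norm)
      then show ?thesis by simp
    qed
    also have "\<dots> = norm (us ! j) * T (ws[j := sgn (us ! j)])"
      using linear_scale[OF mult_formsD(2)[OF T ws(1) j]] by simp
    finally have "T ws = norm (us ! j) * T (ws[j := sgn (us ! j)])" .
    then show ?case
      using Suc us j upd by (simp add: ws_def[symmetric] take_Suc_conv_app_nth)
  qed
  from this[of i] show ?thesis using us by simp
qed

lemma mult_forms_bound:
  assumes T: "T \<in> mult_forms i" and us: "length us = i"
  shows "\<bar>T us\<bar> \<le> mult_norm i T * norms_prod us"
proof -
  have "\<bar>T us\<bar> = norms_prod us * \<bar>T (map sgn us)\<bar>"
    using mult_forms_eq_sgn[OF assms] norms_prod_nonneg[of us] by (metis abs_mult abs_of_nonneg)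
  also have "\<dots> \<le> norms_prod us * mult_norm i T"
    using us by (intro mult_left_mono abs_le_mult_norm[OF T] norms_prod_nonneg) (auto simp: norm_sgn)
  finally show ?thesis by (simp add: mult.commute)
qed

text \<open>
  This is the identification of \<open>L(X; L(X\<^sup>i; \<real>))\<close> with \<open>L(X\<^bsup>i+1\<^esup>; \<real>)\<close>. It shows
  that the derivative of order \<open>k\<close> is a bounded multilinear form; the definition of \<^const>\<open>Cbk\<close>
  says so in curried form.
\<close>

lemma mult_forms_SucI:
  assumes L: "\<And>h. (\<lambda>us. T (h # us)) \<in> mult_forms i"
    and lin: "\<And>us. linear (\<lambda>h. T (h # us))"
    and C: "\<And>h. mult_norm i (\<lambda>us. T (h # us)) \<le> C * norm h"
    and nil: "T [] = 0"
  shows "T \<in> mult_forms (Suc i)"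
  unfolding mult_forms_def mem_Collect_eq
proof (intro conjI allI impI)
  fix us :: "'a list" assume "length us \<noteq> Suc i"
  then show "T us = 0" using nil mult_formsD(1)[OF L] by (cases us) auto
next
  fix us :: "'a list" and j assume us: "length us = Suc i" and j: "j < Suc i"
  obtain w ws where w: "us = w # ws" using us by (cases us) auto
  show "linear (\<lambda>v. T (us[j := v]))"
    using lin mult_formsD(2)[OF L, of ws] us j by (cases j) (auto simp: w)
next
  have "\<bar>T us\<bar> \<le> C * norms_prod us" if us: "length us = Suc i" for us
  proof -
    obtain w ws where w: "us = w # ws" "length ws = i" using us by (cases us) auto
    have "\<bar>T us\<bar> \<le> mult_norm i (\<lambda>us. T (w # us)) * norms_prod ws"
      using mult_forms_bound[OF L w(2)] by (simp add: w)
    also have "\<dots> \<le> C * norm w * norms_prod ws"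
      using C by (intro mult_right_mono norms_prod_nonneg)
    finally show ?thesis by (simp add: w)
  qed
  then show "\<exists>C. \<forall>us. length us = Suc i \<longrightarrow> \<bar>T us\<bar> \<le> C * norms_prod us" by blast
qed

section \<open>The space of bounded functions with bounded continuous derivatives\<close>

lemma deriv_form_apply: "length us = i \<Longrightarrow> deriv_form a i x us = iter_deriv a us x"
  by (simp add: deriv_form_def)

lemma bounded_linear_betweenD:
  assumes "bounded_linear_between V nV from_log_density nW L"
  shows "u \<in> V \<Longrightarrow> L u \<in> from_log_density"
    and "u \<in> V \<Longrightarrow> v \<in> V \<Longrightarrow> L (u + v) = L u + L v"
    and "u \<in> V \<Longrightarrow> L (c *\<^sub>R u) = c *\<^sub>R L u"
    and "\<exists>C. \<forall>u\<in>V. nW (L u) \<le> C * nV u"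
  using assms unfolding bounded_linear_between_def by blast+

lemma has_frechet_derivative_atD:
  assumes "has_frechet_derivative_at V nV from_log_density nW S F F' a"
  shows "b \<in> S \<Longrightarrow> F b \<in> from_log_density" and "bounded_linear_between V nV from_log_density nW F'"
    and "\<epsilon> > 0 \<Longrightarrow> \<exists>\<delta>>0. \<forall>h\<in>V. nV h < \<delta> \<longrightarrow> a + h \<in> S \<longrightarrow>
        nW (F (a + h) - F a - F' h) \<le> \<epsilon> * nV h"
  using assms unfolding has_frechet_derivative_at_def by blast+

lemma CbkD:
  assumes "a \<in> Cbk k B"
  shows "x \<notin> B \<Longrightarrow> a x = 0" "continuous_on B a" "bounded (a ` B)"
    "i < k \<Longrightarrow> x \<in> B \<Longrightarrow> has_frechet_derivative_at UNIV norm (mult_forms i) (mult_norm i) B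
            (deriv_form a i) (\<lambda>h us. deriv_form a (Suc i) x (h # us)) x"
    "1 \<le> i \<Longrightarrow> i \<le> k \<Longrightarrow> x \<in> B \<Longrightarrow> \<epsilon> > 0 \<Longrightarrow> \<exists>\<delta>>0. \<forall>y\<in>B. dist y x < \<delta> \<longrightarrow>
               mult_norm i (deriv_form a i y - deriv_form a i x) < \<epsilon>"
    "1 \<le> i \<Longrightarrow> i \<le> k \<Longrightarrow> bdd_above ((\<lambda>x. mult_norm i (deriv_form a i x)) ` B)"
  using assms unfolding Cbk_def by auto

lemma Cbk_deriv_form_mult_forms:
  assumes a: "a \<in> Cbk k B" and "i \<le> k" and x: "x \<in> B"
  shows "deriv_form a i x \<in> mult_forms i"
proof (cases "i < k")
  case True
  then show ?thesis using has_frechet_derivative_atD(1)[OF CbkD(4)[OF a True x] x] by simp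
next
  case False
  then have i: "i = k" using \<open>i \<le> k\<close> by simp
  show ?thesis
  proof (cases k)
    case 0
    show ?thesis unfolding i 0 mult_forms_def
      by (auto simp: deriv_form_def intro!: exI[of _ "\<bar>a x\<bar>"])
  next
    case (Suc j)
    then have "j < k" by simp
    note bl = has_frechet_derivative_atD(2)[OF CbkD(4)[OF a this x]]
    obtain C where C: "\<And>h. mult_norm j (\<lambda>us. deriv_form a (Suc j) x (h # us)) \<le> C * norm h"
      using bounded_linear_betweenD(4)[OF bl] by auto
    show ?thesis unfolding i Suc
    proof (rule mult_forms_SucI)
      show "(\<lambda>us. deriv_form a (Suc j) x (h # us)) \<in> mult_forms j" for h
        using bounded_linear_betweenD(1)[OF bl] by simp
      show "linear (\<lambda>h. deriv_form a (Suc j) x (h # us))" for us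
      proof (rule linearI)
        show "deriv_form a (Suc j) x ((u + v) # us) = deriv_form a (Suc j) x (u # us) + deriv_form a (Suc j) x (v # us)" for u v
          using fun_cong[OF bounded_linear_betweenD(2)[OF bl, of u v], of us] by simp
        show "deriv_form a (Suc j) x ((c *\<^sub>R u) # us) = c *\<^sub>R deriv_form a (Suc j) x (u # us)" for c u
          using fun_cong[OF bounded_linear_betweenD(3)[OF bl, of u c], of us] by simp
      qed
    qed (use C in \<open>auto simp: deriv_form_def\<close>)
  qed
qed

lemma Cbk_bounded_continuous_forms:
  assumes a: "a \<in> Cbk k B" and i: "i \<le> k"
  shows "bounded_continuous_forms B i (iter_deriv a)"
proof (cases "i = 0")
  case True
  have "bounded_continuous_forms B 0 (iter_deriv a) \<longleftrightarrow> bounded_continuous_forms B 0 (\<lambda>_. a)"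
    by (rule bounded_continuous_forms_cong) simp
  then show ?thesis
    using True CbkD(2,3)[OF a] by (simp add: bounded_continuous_forms_0_iff)
next
  case False
  then have i1: "1 \<le> i" by simp
  show ?thesis
    unfolding bounded_continuous_forms_def
  proof (intro conjI ballI allI impI)
    obtain C where C: "\<And>x. x \<in> B \<Longrightarrow> mult_norm i (deriv_form a i x) \<le> C"
      using CbkD(6)[OF a i1 i] by (auto simp: bdd_above_def)
    have "\<bar>iter_deriv a us x\<bar> \<le> C * norms_prod us" if "x \<in> B" "length us = i" for x us
      using mult_forms_bound[OF Cbk_deriv_form_mult_forms[OF a i that(1)] that(2)]
        mult_right_mono[OF C[OF that(1)] norms_prod_nonneg[of us]] that(2)
      by (simp add: deriv_form_apply)
    then show "\<exists>C. \<forall>x\<in>B. \<forall>us. length us = i \<longrightarrow> \<bar>iter_deriv a us x\<bar> \<le> C * norms_prod us"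
      by blast
  next
    fix x and e :: real assume x: "x \<in> B" and "e > 0"
    then obtain d where d: "d > 0" "\<And>y. y \<in> B \<Longrightarrow> dist y x < d \<Longrightarrow>
        mult_norm i (deriv_form a i y - deriv_form a i x) < e"
      using CbkD(5)[OF a i1 i x] by blast
    show "\<exists>\<delta>>0. \<forall>y\<in>B. dist y x < \<delta> \<longrightarrow> (\<forall>us. length us = i \<longrightarrow>
        \<bar>iter_deriv a us y - iter_deriv a us x\<bar> \<le> e * norms_prod us)"
    proof (intro exI[of _ d] conjI ballI impI allI d(1))
      fix y and us :: "'a list" assume y: "y \<in> B" "dist y x < d" and us: "length us = i"
      have "deriv_form a i y - deriv_form a i x \<in> mult_forms i"
        using Cbk_deriv_form_mult_forms[OF a i] x y(1) by (intro mult_forms_diff)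
      from mult_forms_bound[OF this us]
      have "\<bar>iter_deriv a us y - iter_deriv a us x\<bar> \<le> mult_norm i (deriv_form a i y - deriv_form a i x) * norms_prod us"
        using us by (simp add: deriv_form_apply)
      also have "\<dots> \<le> e * norms_prod us"
        using d(2)[OF y] by (intro mult_right_mono norms_prod_nonneg) auto
      finally show "\<bar>iter_deriv a us y - iter_deriv a us x\<bar> \<le> e * norms_prod us" .
    qed
  qed
qed

lemma Cbk_forms_derivative:
  assumes a: "a \<in> Cbk k B" and i: "i < k"
  shows "forms_derivative B i (iter_deriv a) (iter_deriv a)"
  unfolding forms_derivative_def
proof (intro ballI conjI allI impI)
  fix x and us :: "'a list" assume x: "x \<in> B" and us: "length us = i"
  have "linear (\<lambda>v. deriv_form a (Suc i) x ((0 # us)[0 := v]))"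
    using i us by (intro mult_formsD(2)[OF Cbk_deriv_form_mult_forms[OF a _ x]]) auto
  then show "linear (\<lambda>h. iter_deriv a (h # us) x)"
    using us by (simp add: deriv_form_def)
next
  fix x and e :: real assume x: "x \<in> B" and e: "e > 0"
  note fd = CbkD(4)[OF a i x]
  obtain d where d: "d > 0" "\<And>h. norm h < d \<Longrightarrow> x + h \<in> B \<Longrightarrow>
      mult_norm i (deriv_form a i (x + h) - deriv_form a i x - (\<lambda>us. deriv_form a (Suc i) x (h # us))) \<le> e * norm h"
    using has_frechet_derivative_atD(3)[OF fd e] by auto
  show "\<exists>\<delta>>0. \<forall>h. norm h < \<delta> \<longrightarrow> x + h \<in> B \<longrightarrow> (\<forall>us. length us = i \<longrightarrow>
      \<bar>iter_deriv a us (x + h) - iter_deriv a us x - iter_deriv a (h # us) x\<bar> \<le> e * norm h * norms_prod us)"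
  proof (intro exI[of _ d] conjI impI allI d(1))
    fix h and us :: "'a list" assume h: "norm h < d" "x + h \<in> B" and us: "length us = i"
    have "deriv_form a i (x + h) - deriv_form a i x - (\<lambda>us. deriv_form a (Suc i) x (h # us)) \<in> mult_forms i"
      using Cbk_deriv_form_mult_forms[OF a less_imp_le[OF i]] x h(2)
        bounded_linear_betweenD(1)[OF has_frechet_derivative_atD(2)[OF fd]] by (intro mult_forms_diff) auto
    from mult_forms_bound[OF this us] us
    have "\<bar>iter_deriv a us (x + h) - iter_deriv a us x - iter_deriv a (h # us) x\<bar> \<le>
      mult_norm i (deriv_form a i (x + h) - deriv_form a i x - (\<lambda>us. deriv_form a (Suc i) x (h # us))) * norms_prod us"
      by (simp add: deriv_form_def)
    also have "\<dots> \<le> e * norm h * norms_prod us"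
      using d(2)[OF h] by (intro mult_right_mono norms_prod_nonneg) auto
    finally show "\<bar>iter_deriv a us (x + h) - iter_deriv a us x - iter_deriv a (h # us) x\<bar> \<le> e * norm h * norms_prod us" .
  qed
qed

lemma Cbk_imp_smooth_forms:
  assumes a: "a \<in> Cbk k B"
  shows "smooth_forms B k 0 (\<lambda>_. a)"
proof -
  have "smooth_forms B m i (iter_deriv a)" if "m + i = k" for m i
    using that
  proof (induction m arbitrary: i)
    case 0
    then show ?case using Cbk_bounded_continuous_forms[OF a] by simp
  next
    case (Suc m)
    show ?case
      using Suc Cbk_bounded_continuous_forms[OF a, of i] Cbk_forms_derivative[OF a, of i]
      by (intro smooth_forms_SucI[where \<Phi>' = "iter_deriv a"]) auto
  qed
  then have "smooth_forms B k 0 (iter_deriv a)" by simp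
  moreover have "smooth_forms B k 0 (iter_deriv a) \<longleftrightarrow> smooth_forms B k 0 (\<lambda>_. a)"
    by (rule smooth_forms_cong) simp
  ultimately show ?thesis by simp
qed

text \<open>
  Frechet derivatives on an open set are unique, so the derivatives provided by
  \<^const>\<open>smooth_forms\<close> are the iterated directional derivatives.
\<close>

lemma smooth_forms_iter_deriv:
  assumes "open B" and "smooth_forms B m i \<Phi>"
    and "\<And>us x. length us = i \<Longrightarrow> x \<in> B \<Longrightarrow> \<Phi> us x = iter_deriv a us x"
  shows "(\<forall>j\<le>m. bounded_continuous_forms B (i + j) (iter_deriv a)) \<and>
    (\<forall>j<m. forms_derivative B (i + j) (iter_deriv a) (iter_deriv a))"
  using assms(2,3)
proof (induction m arbitrary: i \<Phi>)
  case 0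
  have "bounded_continuous_forms B i \<Phi> \<longleftrightarrow> bounded_continuous_forms B i (iter_deriv a)"
    by (rule bounded_continuous_forms_cong) (rule 0)
  with 0 show ?case by simp
next
  case (Suc m)
  obtain \<Phi>' where \<Phi>': "forms_derivative B i \<Phi> \<Phi>'" "smooth_forms B m (Suc i) \<Phi>'"
    using Suc.prems(1) by auto
  have eq: "\<Phi>' us x = iter_deriv a us x" if us: "length us = Suc i" and x: "x \<in> B" for us x
  proof -
    obtain w ws where w: "us = w # ws" "length ws = i" using us by (cases us) auto
    have "(\<Phi> ws has_derivative (\<lambda>h. \<Phi>' (h # ws) x)) (at x)"
      by (rule forms_derivative_imp_has_derivative[OF \<open>open B\<close> \<Phi>'(1)
            smooth_forms_bounded_continuous[OF \<Phi>'(2)] x w(2)])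
    then have "(iter_deriv a ws has_derivative (\<lambda>h. \<Phi>' (h # ws) x)) (at x)"
      by (rule has_derivative_transform_within_open[OF _ \<open>open B\<close> x]) (rule Suc.prems(2)[OF w(2)])
    then have "(\<lambda>h. \<Phi>' (h # ws) x) = frechet_derivative (iter_deriv a ws) (at x)"
      by (rule frechet_derivative_at)
    then show ?thesis by (simp add: w fun_eq_iff)
  qed
  have IH: "(\<forall>j\<le>m. bounded_continuous_forms B (Suc i + j) (iter_deriv a)) \<and>
    (\<forall>j<m. forms_derivative B (Suc i + j) (iter_deriv a) (iter_deriv a))"
    by (rule Suc.IH[OF \<Phi>'(2)]) (rule eq)
  have bc: "bounded_continuous_forms B i \<Phi> \<longleftrightarrow> bounded_continuous_forms B i (iter_deriv a)"
    by (rule bounded_continuous_forms_cong) (rule Suc.prems(2))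
  have fd: "forms_derivative B i \<Phi> \<Phi>' \<longleftrightarrow> forms_derivative B i (iter_deriv a) (iter_deriv a)"
    by (rule forms_derivative_cong) (rule Suc.prems(2) eq; assumption)+
  show ?case
  proof (intro conjI allI impI)
    fix j assume "j \<le> Suc m"
    then show "bounded_continuous_forms B (i + j) (iter_deriv a)"
      using IH bc smooth_forms_bounded_continuous[OF Suc.prems(1)] by (cases j) auto
  next
    fix j assume "j < Suc m"
    then show "forms_derivative B (i + j) (iter_deriv a) (iter_deriv a)"
      using IH fd \<Phi>'(1) by (cases j) auto
  qed
qed

text \<open>
  The last direction added enters linearly because a Frechet derivative is linear. For the earlier
  ones, linearity at all points of the open set \<open>B\<close> is preserved by differentiation.
\<close>

lemma iter_deriv_multilinear:
  assumes "open B"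
    and bc: "\<And>j. j < i \<Longrightarrow> bounded_continuous_forms B (Suc j) (iter_deriv a)"
    and fd: "\<And>j. j < i \<Longrightarrow> forms_derivative B j (iter_deriv a) (iter_deriv a)"
    and "length us = i" "j < i" "x \<in> B"
  shows "linear (\<lambda>v. iter_deriv a (us[j := v]) x)"
  using bc fd assms(4-6)
proof (induction i arbitrary: us j x)
  case 0
  then show ?case by simp
next
  case (Suc i)
  \<comment> \<open>The head of the list is the direction of the last differentiation.\<close>
  obtain w ws where w: "us = w # ws" "length ws = i" using Suc.prems(3) by (cases us) auto
  have deriv: "(iter_deriv a vs has_derivative (\<lambda>h. iter_deriv a (h # vs) x)) (at x)" if "length vs = i" for vs
    by (rule forms_derivative_imp_has_derivative[OF \<open>open B\<close> Suc.prems(2,1) \<open>x \<in> B\<close> that]) simp_all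
  show ?case
  proof (cases j)
    case 0
    show ?thesis
      using forms_derivativeD_linear[OF Suc.prems(2)[of i] \<open>x \<in> B\<close> w(2)] by (simp add: 0 w)
  next
    case (Suc j')
    then have j': "j' < i" using \<open>j < Suc i\<close> by simp
    have lin: "linear (\<lambda>v. iter_deriv a (ws[j' := v]) y)" if "y \<in> B" for y
      using Suc.IH[OF _ _ w(2) j' that] Suc.prems(1,2) by simp
    have fre: "iter_deriv a (w # vs) x = frechet_derivative (iter_deriv a vs) (at x) w" for vs
      by simp
    show ?thesis
    proof (rule linearI)
      fix u v
      have "((\<lambda>y. iter_deriv a (ws[j' := u]) y + iter_deriv a (ws[j' := v]) y) has_derivative
          (\<lambda>h. iter_deriv a (h # ws[j' := u]) x + iter_deriv a (h # ws[j' := v]) x)) (at x)"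
        by (intro has_derivative_add deriv) (simp_all add: w)
      then have "(iter_deriv a (ws[j' := u + v]) has_derivative
          (\<lambda>h. iter_deriv a (h # ws[j' := u]) x + iter_deriv a (h # ws[j' := v]) x)) (at x)"
        by (rule has_derivative_transform_within_open[OF _ \<open>open B\<close> \<open>x \<in> B\<close>]) (simp add: linear_add[OF lin])
      from has_derivative_unique[OF this deriv] w(2)
      show "iter_deriv a (us[j := u + v]) x = iter_deriv a (us[j := u]) x + iter_deriv a (us[j := v]) x"
        unfolding w(1) Suc list_update.simps nat.case by (metis length_list_update)
    next
      fix c v
      have "((\<lambda>y. c *\<^sub>R iter_deriv a (ws[j' := v]) y) has_derivative
          (\<lambda>h. c *\<^sub>R iter_deriv a (h # ws[j' := v]) x)) (at x)"
        by (intro has_derivative_scaleR_right deriv) (simp_all add: w)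
      then have "(iter_deriv a (ws[j' := c *\<^sub>R v]) has_derivative
          (\<lambda>h. c *\<^sub>R iter_deriv a (h # ws[j' := v]) x)) (at x)"
        by (rule has_derivative_transform_within_open[OF _ \<open>open B\<close> \<open>x \<in> B\<close>]) (use linear_scale[OF lin] in simp)
      from has_derivative_unique[OF this deriv] w(2)
      show "iter_deriv a (us[j := c *\<^sub>R v]) x = c *\<^sub>R iter_deriv a (us[j := v]) x"
        unfolding w(1) Suc list_update.simps nat.case by (metis length_list_update)
    qed
  qed
qed

text \<open>
  Through this characterisation \<open>C\<^sub>b\<^sup>k\<close> inherits the closure properties of \<^const>\<open>smooth_forms\<close>.
\<close>

lemma Cbk_iff_smooth_forms:
  assumes "open B"
  shows "a \<in> Cbk k B \<longleftrightarrow> (\<forall>x. x \<notin> B \<longrightarrow> a x = 0) \<and> smooth_forms B k 0 (\<lambda>_. a)"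
proof (intro iffI conjI)
  assume "a \<in> Cbk k B"
  then show "\<forall>x. x \<notin> B \<longrightarrow> a x = 0" "smooth_forms B k 0 (\<lambda>_. a)"
    using CbkD(1) Cbk_imp_smooth_forms by blast+
next
  assume "(\<forall>x. x \<notin> B \<longrightarrow> a x = 0) \<and> smooth_forms B k 0 (\<lambda>_. a)"
  then have zero: "\<forall>x. x \<notin> B \<longrightarrow> a x = 0" and sm: "smooth_forms B k 0 (\<lambda>_. a)" by blast+
  have all: "(\<forall>j\<le>k. bounded_continuous_forms B (0 + j) (iter_deriv a)) \<and>
    (\<forall>j<k. forms_derivative B (0 + j) (iter_deriv a) (iter_deriv a))"
    by (rule smooth_forms_iter_deriv[OF \<open>open B\<close> sm]) simp
  then have bc: "\<And>j. j \<le> k \<Longrightarrow> bounded_continuous_forms B j (iter_deriv a)"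
    and fd: "\<And>j. j < k \<Longrightarrow> forms_derivative B j (iter_deriv a) (iter_deriv a)" by simp_all
  have mf: "deriv_form a i x \<in> mult_forms i" if i: "i \<le> k" and x: "x \<in> B" for i x
    unfolding mult_forms_def mem_Collect_eq
  proof (intro conjI allI impI)
    obtain C where "C > 0" "\<And>x us. x \<in> B \<Longrightarrow> length us = i \<Longrightarrow> \<bar>iter_deriv a us x\<bar> \<le> C * norms_prod us"
      by (rule bounded_continuous_formsD_bound[OF bc[OF i]]) (rule that)
    then show "\<exists>C. \<forall>us. length us = i \<longrightarrow> \<bar>deriv_form a i x us\<bar> \<le> C * norms_prod us"
      using x by (auto simp: deriv_form_def)
  next
    fix us :: "'a list" and j assume us: "length us = i" and j: "j < i"
    have "linear (\<lambda>v. iter_deriv a (us[j := v]) x)"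
      using i by (intro iter_deriv_multilinear[OF \<open>open B\<close> bc fd us j x]) auto
    then show "linear (\<lambda>v. deriv_form a i x (us[j := v]))"
      using us by (simp add: deriv_form_def)
  qed (simp add: deriv_form_def)
  have bcs: "bounded (a ` B) \<and> continuous_on B a"
    using smooth_forms_bounded_continuous[OF sm] by (simp add: bounded_continuous_forms_0_iff)
  have frechet: "has_frechet_derivative_at UNIV norm (mult_forms i) (mult_norm i) B
            (deriv_form a i) (\<lambda>h us. deriv_form a (Suc i) x (h # us)) x" if i: "i < k" and x: "x \<in> B" for i x
    unfolding has_frechet_derivative_at_def
  proof (intro conjI ballI allI impI)
    show "\<exists>\<delta>>0. \<forall>h\<in>UNIV. norm h < \<delta> \<longrightarrow> x + h \<in> B"
    proof -
      obtain d where "d > 0" "\<And>y. dist y x < d \<Longrightarrow> y \<in> B"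
        using \<open>open B\<close> x unfolding open_dist by blast
      then show ?thesis by (intro exI[of _ d]) (auto simp: dist_norm)
    qed
    show "bounded_linear_between UNIV norm (mult_forms i) (mult_norm i) (\<lambda>h us. deriv_form a (Suc i) x (h # us))"
      unfolding bounded_linear_between_def
    proof (intro conjI ballI allI)
      have mfS: "deriv_form a (Suc i) x \<in> mult_forms (Suc i)" using i by (intro mf x) simp
      have lin: "linear (\<lambda>h. deriv_form a (Suc i) x (h # us))" for us
      proof (cases "length us = i")
        case True
        then show ?thesis using mult_formsD(2)[OF mfS, of "0 # us" 0] by simp
      next
        case False
        then show ?thesis by (simp add: deriv_form_def module_hom_zero)
      qed
      show "(\<lambda>us. deriv_form a (Suc i) x ((u + v) # us))
          = (\<lambda>us. deriv_form a (Suc i) x (u # us)) + (\<lambda>us. deriv_form a (Suc i) x (v # us))" for u v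
        using linear_add[OF lin] by (simp add: fun_eq_iff)
      show "(\<lambda>us. deriv_form a (Suc i) x ((c *\<^sub>R u) # us)) = c *\<^sub>R (\<lambda>us. deriv_form a (Suc i) x (u # us))" for c u
        using linear_scale[OF lin] by (simp add: fun_eq_iff)
      obtain C where C: "C > 0" "\<And>x us. x \<in> B \<Longrightarrow> length us = Suc i \<Longrightarrow> \<bar>iter_deriv a us x\<bar> \<le> C * norms_prod us"
        using bounded_continuous_formsD_bound[OF bc[of "Suc i"]] i by auto
      have C': "\<bar>deriv_form a (Suc i) x (h # us)\<bar> \<le> (C * norm h) * norms_prod us" if "length us = i" for h us
        using C(2)[OF x, of "h # us"] that by (simp add: deriv_form_def mult.assoc del: iter_deriv.simps)
      show "\<exists>C. \<forall>h\<in>UNIV. mult_norm i (\<lambda>us. deriv_form a (Suc i) x (h # us)) \<le> C * norm h"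
        using C' C(1) by (intro exI[of _ C] ballI mult_norm_leI) auto
      show "(\<lambda>us. deriv_form a (Suc i) x (h # us)) \<in> mult_forms i" for h
        unfolding mult_forms_def mem_Collect_eq
      proof (intro conjI allI impI)
        show "\<exists>C. \<forall>us. length us = i \<longrightarrow> \<bar>deriv_form a (Suc i) x (h # us)\<bar> \<le> C * norms_prod us"
          using C' by blast
        fix us :: "'a list" and j assume "length us = i" "j < i"
        then show "linear (\<lambda>v. deriv_form a (Suc i) x (h # us[j := v]))"
          using mult_formsD(2)[OF mfS, of "h # us" "Suc j"] by simp
      qed (simp add: deriv_form_def)
    qed
    fix e :: real assume e: "e > 0"
    obtain d where d: "d > 0" "\<And>h us. norm h < d \<Longrightarrow> x + h \<in> B \<Longrightarrow> length us = i \<Longrightarrow>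
      \<bar>iter_deriv a us (x + h) - iter_deriv a us x - iter_deriv a (h # us) x\<bar> \<le> e * norm h * norms_prod us"
      by (rule forms_derivativeD_remainder[OF fd[OF i] x e]) (rule that)
    show "\<exists>\<delta>>0. \<forall>h\<in>UNIV. norm h < \<delta> \<longrightarrow> x + h \<in> B \<longrightarrow>
        mult_norm i (deriv_form a i (x + h) - deriv_form a i x - (\<lambda>us. deriv_form a (Suc i) x (h # us))) \<le> e * norm h"
      using d e by (intro exI[of _ d] conjI ballI impI mult_norm_leI)
        (simp_all add: deriv_form_def del: iter_deriv.simps)
  qed (use x mf i in auto)
  have cont: "\<exists>\<delta>>0. \<forall>y\<in>B. dist y x < \<delta> \<longrightarrow> mult_norm i (deriv_form a i y - deriv_form a i x) < e"
    if i: "i \<le> k" and x: "x \<in> B" and e: "e > 0" for i x and e :: real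
  proof -
    have e2: "e / 2 > 0" using e by simp
    obtain d where d: "d > 0" "\<And>y us. y \<in> B \<Longrightarrow> dist y x < d \<Longrightarrow> length us = i \<Longrightarrow>
        \<bar>iter_deriv a us y - iter_deriv a us x\<bar> \<le> e / 2 * norms_prod us"
      by (rule bounded_continuous_formsD_cont[OF bc[OF i] x e2]) (rule that)
    have "mult_norm i (deriv_form a i y - deriv_form a i x) \<le> e / 2" if "y \<in> B" "dist y x < d" for y
      using d(2)[OF that] e by (intro mult_norm_leI) (simp_all add: deriv_form_def)
    with d(1) e show ?thesis by (intro exI[of _ d]) force
  qed
  have bdd: "bdd_above ((\<lambda>x. mult_norm i (deriv_form a i x)) ` B)" if i: "i \<le> k" for i
  proof -
    obtain C where C: "C > 0" "\<And>x us. x \<in> B \<Longrightarrow> length us = i \<Longrightarrow> \<bar>iter_deriv a us x\<bar> \<le> C * norms_prod us"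
      by (rule bounded_continuous_formsD_bound[OF bc[OF i]]) (rule that)
    then have "mult_norm i (deriv_form a i x) \<le> C" if "x \<in> B" for x
      using that by (intro mult_norm_leI) (simp_all add: deriv_form_def)
    then show ?thesis by (auto simp: bdd_above_def)
  qed
  show "a \<in> Cbk k B"
    unfolding Cbk_def mem_Collect_eq using zero bcs frechet cont bdd by auto
qed

lemma Cbk_add:
  assumes "open B" "a \<in> Cbk k B" "b \<in> Cbk k B"
  shows "a + b \<in> Cbk k B"
  using assms smooth_forms_add[of B k 0 "\<lambda>_. a" "\<lambda>_. b"]
  by (simp add: Cbk_iff_smooth_forms plus_fun_def)

lemma Cbk_zero: "open B \<Longrightarrow> 0 \<in> Cbk k B"
  using smooth_forms_zero[of B k 0] by (simp add: Cbk_iff_smooth_forms zero_fun_def)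

lemma Cbk_compose:
  fixes f :: "nat \<Rightarrow> real \<Rightarrow> real"
  assumes "open B" and "a \<in> Cbk k B" and K: "compact K" "a ` B \<subseteq> K"
    and f: "\<And>n t. t \<in> K \<Longrightarrow> (f n has_real_derivative f (Suc n) t) (at t)"
    and "f 0 0 = 0"
  shows "(\<lambda>x. f 0 (a x)) \<in> Cbk k B"
  using smooth_forms_compose[of B k a K f 0] assms by (simp add: Cbk_iff_smooth_forms)

section \<open>The scalar coordinate and the scalar divergence\<close>

text \<open>
  The coordinate \<open>phi \<alpha>\<close> is this function applied to the logarithm of the density. With
  \<open>\<beta> = (1 - \<alpha>) / 2\<close> it is \<open>(exp (\<beta> t) - 1) / \<beta>\<close>, the primitive of \<open>exp (\<beta> t)\<close> that vanishes at \<open>0\<close>, and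
  \<open>\<alpha> = 1\<close> is the limit as \<open>\<beta>\<close> tends to \<open>0\<close>.
\<close>

definition emb :: "real \<Rightarrow> real \<Rightarrow> real" where
  "emb \<alpha> t = (if \<alpha> = 1 then t else 2 / (1 - \<alpha>) * (exp ((1 - \<alpha>) / 2 * t) - 1))"

definition emb_inv :: "real \<Rightarrow> real \<Rightarrow> real" where
  "emb_inv \<alpha> y = (if \<alpha> = 1 then y else 2 / (1 - \<alpha>) * ln (1 + (1 - \<alpha>) / 2 * y))"

text \<open>
  The integrand of the divergence, in terms of the two log densities.
\<close>

definition pointwise_divergence :: "real \<Rightarrow> real \<Rightarrow> real \<Rightarrow> real" where
  "pointwise_divergence \<alpha> s t =
     (if \<alpha> = -1 then emb (-1) t - emb (-1) s + (emb (-1) s + 1) * (s - t)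
      else if \<alpha> = 1 then emb (-1) s - emb (-1) t + (emb (-1) t + 1) * (t - s)
      else 2 / (1 + \<alpha>) * (emb (-1) s - emb \<alpha> s) + 2 / (1 - \<alpha>) * (emb (-1) t - emb (-\<alpha>) t)
           - emb \<alpha> s * emb (-\<alpha>) t)"

lemma emb_1 [simp]: "emb 1 t = t" and emb_minus_1: "emb (-1) t = exp t - 1"
  and emb_0 [simp]: "emb \<alpha> 0 = 0" and emb_inv_0 [simp]: "emb_inv \<alpha> 0 = 0"
  by (simp_all add: emb_def emb_inv_def)

text \<open>
  Positivity of the right-hand side confines the values of the coordinate to the half line
  \<open>1 + (1 - \<alpha>) / 2 * y > 0\<close>, which is the whole line if \<open>\<alpha> = 1\<close>. All of it is attained, by
  \<open>emb_emb_inv\<close>.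
\<close>

lemma one_plus_emb: "1 + (1 - \<alpha>) / 2 * emb \<alpha> t = exp ((1 - \<alpha>) / 2 * t)"
proof (cases "\<alpha> = 1")
  case False
  have "c / 2 * (2 / c * z) = z" if "c \<noteq> 0" for c z :: real using that by simp
  from this[of "1 - \<alpha>" "exp ((1 - \<alpha>) / 2 * t) - 1"] False have
    "(1 - \<alpha>) / 2 * emb \<alpha> t = exp ((1 - \<alpha>) / 2 * t) - 1" by (simp add: emb_def)
  then show ?thesis by linarith
qed simp

lemma exp_emb_inv:
  assumes "0 < 1 + (1 - \<alpha>) / 2 * y"
  shows "exp ((1 - \<alpha>) / 2 * emb_inv \<alpha> y) = 1 + (1 - \<alpha>) / 2 * y"
proof (cases "\<alpha> = 1")
  case False
  have "c / 2 * (2 / c * z) = z" if "c \<noteq> 0" for c z :: real using that by simp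
  from this[of "1 - \<alpha>" "ln (1 + (1 - \<alpha>) / 2 * y)"] False have
    "(1 - \<alpha>) / 2 * emb_inv \<alpha> y = ln (1 + (1 - \<alpha>) / 2 * y)" by (simp add: emb_inv_def)
  then show ?thesis using assms by (simp only: exp_ln)
qed simp

lemma emb_inv_emb [simp]: "emb_inv \<alpha> (emb \<alpha> t) = t"
proof (cases "\<alpha> = 1")
  case False
  have "2 / c * (c / 2 * z) = z" if "c \<noteq> 0" for c z :: real using that by simp
  from this[of "1 - \<alpha>"] False show ?thesis by (simp only: emb_inv_def one_plus_emb ln_exp) simp
qed (simp add: emb_inv_def)

lemma emb_emb_inv [simp]:
  assumes "0 < 1 + (1 - \<alpha>) / 2 * y"
  shows "emb \<alpha> (emb_inv \<alpha> y) = y"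
proof (cases "\<alpha> = 1")
  case False
  have "2 / c * (1 + c / 2 * z - 1) = z" if "c \<noteq> 0" for c z :: real using that by simp
  from this[of "1 - \<alpha>" y] False show ?thesis
    unfolding emb_def[of \<alpha> "emb_inv \<alpha> y"] exp_emb_inv[OF assms] by simp
qed (simp add: emb_inv_def)

lemma DERIV_emb: "(emb \<alpha> has_real_derivative exp ((1 - \<alpha>) / 2 * t)) (at t)"
proof (cases "\<alpha> = 1")
  case True
  then have "emb \<alpha> = (\<lambda>t. t)" by auto
  then show ?thesis using True by simp
next
  case False
  have "((\<lambda>t. 2 / c * (exp (c / 2 * t) - 1)) has_real_derivative exp (c / 2 * t)) (at t)"
    if "c \<noteq> 0" for c :: real
    using that by (auto intro!: derivative_eq_intros)
  from this[of "1 - \<alpha>"] show ?thesis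
    using False unfolding emb_def by simp
qed

lemma DERIV_emb_inv:
  assumes "0 < 1 + (1 - \<alpha>) / 2 * y"
  shows "(emb_inv \<alpha> has_real_derivative inverse (1 + (1 - \<alpha>) / 2 * y)) (at y)"
proof (cases "\<alpha> = 1")
  case True
  then have "emb_inv \<alpha> = (\<lambda>t. t)" by (auto simp: emb_inv_def)
  then show ?thesis using True by simp
next
  case False
  have "((\<lambda>y. 2 / c * ln (1 + c / 2 * y)) has_real_derivative inverse (1 + c / 2 * y)) (at y)"
    if "c \<noteq> 0" "0 < 1 + c / 2 * y" for c :: real
  proof -
    have "((\<lambda>y. ln (1 + c / 2 * y)) has_real_derivative c / 2 * inverse (1 + c / 2 * y)) (at y)"
      using DERIV_chain2[OF DERIV_ln[OF that(2)] DERIV_add[OF DERIV_const DERIV_cmult[OF DERIV_ident]]]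
      by (simp add: mult.commute)
    from DERIV_cmult[OF this, of "2 / c"] that(1) show ?thesis by simp
  qed
  from this[of "1 - \<alpha>"] show ?thesis
    using False assms unfolding emb_inv_def by simp
qed

lemma emb_strict_mono: "strict_mono (emb \<alpha>)"
proof (rule strict_monoI)
  fix s t :: real assume "s < t"
  then show "emb \<alpha> s < emb \<alpha> t"
    by (rule DERIV_pos_imp_increasing) (blast intro: DERIV_emb exp_gt_zero)
qed

lemma pointwise_divergence_minus: "pointwise_divergence (-\<alpha>) s t = pointwise_divergence \<alpha> t s"
  by (auto simp: pointwise_divergence_def)

lemma pointwise_divergence_self [simp]: "pointwise_divergence \<alpha> s s = 0"
proof (cases "\<alpha> = 1 \<or> \<alpha> = -1")
  case False
  define p q where "p = exp ((1 - \<alpha>) / 2 * s)" and "q = exp ((1 + \<alpha>) / 2 * s)"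
  define u v where "u = 2 / (1 + \<alpha>)" and "v = 2 / (1 - \<alpha>)"
  \<comment> \<open>The weights \<open>(1 + \<alpha>) / 2\<close> and \<open>(1 - \<alpha>) / 2\<close> add up to \<open>1\<close>, so the sum of their inverses
    equals the product, and the terms below cancel.\<close>
  have "2 / c + 2 / d = 2 / c * (2 / d)" if "c \<noteq> 0" "d \<noteq> 0" "c + d = 2" for c d :: real
    using that by (simp add: field_simps)
  from this[of "1 + \<alpha>" "1 - \<alpha>"] have uv: "u + v = u * v"
    using False unfolding u_def v_def by (simp add: add_eq_0_iff)
  have pq: "exp s = p * q"
    unfolding p_def q_def exp_add[symmetric] by (simp add: field_simps)
  have "emb \<alpha> s = v * (p - 1)" "emb (-\<alpha>) s = u * (q - 1)"
    using False by (simp_all add: emb_def p_def q_def u_def v_def)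
  then have "pointwise_divergence \<alpha> s s = u * (p * q - 1 - v * (p - 1)) + v * (p * q - 1 - u * (q - 1))
      - v * (p - 1) * (u * (q - 1))"
    using False by (simp only: pointwise_divergence_def emb_minus_1 pq u_def[symmetric] v_def[symmetric]) simp
  also have "\<dots> = (u + v - u * v) * (p * q - 1)" by algebra
  finally show ?thesis using uv by simp
qed (auto simp: pointwise_divergence_def)

text \<open>
  Off the exceptional values the scalar divergence is a function of \<open>s\<close> plus a function of \<open>t\<close> minus
  the product of dual coordinates. For any function of this form the identity says just that the
  divergence vanishes at \<open>(q, q)\<close>.
\<close>

lemma pointwise_divergence_three_point:
  "pointwise_divergence \<alpha> s r = pointwise_divergence \<alpha> s q + pointwise_divergence \<alpha> q r - (emb \<alpha> s - emb \<alpha> q) * (emb (-\<alpha>) r - emb (-\<alpha>) q)"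
proof (cases "\<alpha> = 1 \<or> \<alpha> = -1")
  case True
  then show ?thesis by (auto simp: pointwise_divergence_def algebra_simps)
next
  case False
  define A B where "A s = 2 / (1 + \<alpha>) * (emb (-1) s - emb \<alpha> s)"
    and "B t = 2 / (1 - \<alpha>) * (emb (-1) t - emb (-\<alpha>) t)" for s t
  have eq: "pointwise_divergence \<alpha> s t = A s + B t - emb \<alpha> s * emb (-\<alpha>) t" for s t
    using False unfolding pointwise_divergence_def A_def B_def by simp
  have "A q + B q = emb \<alpha> q * emb (-\<alpha>) q" using pointwise_divergence_self[of \<alpha> q] unfolding eq by linarith
  then show ?thesis unfolding eq by algebra
qed

text \<open>
  The derivative has the sign of \<open>s - t\<close> because \<open>emb (-\<alpha>)\<close> is increasing. This gives positivity for
  all \<open>\<alpha>\<close> at once, whereas Young's inequality changes direction outside \<open>-1 < \<alpha> < 1\<close>.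
\<close>

lemma DERIV_pointwise_divergence:
  "((\<lambda>s. pointwise_divergence \<alpha> s t) has_real_derivative exp ((1 - \<alpha>) / 2 * s) * (emb (-\<alpha>) s - emb (-\<alpha>) t)) (at s)"
proof -
  consider "\<alpha> = 1" | "\<alpha> = -1" | "\<alpha> \<noteq> 1" "\<alpha> \<noteq> -1" by blast
  then show ?thesis
  proof cases
    case 1
    then show ?thesis
      by (auto simp: pointwise_divergence_def emb_minus_1 intro!: derivative_eq_intros)
  next
    case 2
    then show ?thesis
      by (auto simp: pointwise_divergence_def emb_minus_1 intro!: derivative_eq_intros simp: algebra_simps)
  next
    case 3
    define p q u where "p = exp ((1 - \<alpha>) / 2 * s)" and "q = exp ((1 + \<alpha>) / 2 * s)"
      and "u = 2 / (1 + \<alpha>)"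
    have pq: "exp s = p * q"
      unfolding p_def q_def exp_add[symmetric] by (simp add: field_simps)
    have q: "emb (-\<alpha>) s = u * (q - 1)" using 3 by (simp add: emb_def q_def u_def)
    have "((\<lambda>s. u * (emb (-1) s - emb \<alpha> s) + 2 / (1 - \<alpha>) * (emb (-1) t - emb (-\<alpha>) t)
           - emb \<alpha> s * emb (-\<alpha>) t) has_real_derivative
           u * (p * q - p) - p * emb (-\<alpha>) t) (at s)"
      using DERIV_emb[of "-1" s] DERIV_emb[of \<alpha> s] unfolding p_def[symmetric]
      by (auto intro!: derivative_eq_intros simp: pq)
    moreover have "u * (p * q - p) - p * emb (-\<alpha>) t
        = exp ((1 - \<alpha>) / 2 * s) * (emb (-\<alpha>) s - emb (-\<alpha>) t)"
      unfolding q p_def[symmetric] by (simp add: algebra_simps)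
    ultimately show ?thesis using 3 by (simp add: pointwise_divergence_def u_def)
  qed
qed

lemma pointwise_divergence_pos:
  assumes "s \<noteq> t"
  shows "0 < pointwise_divergence \<alpha> s t"
proof (cases "t < s")
  case True
  obtain z where z: "t < z" "pointwise_divergence \<alpha> s t - pointwise_divergence \<alpha> t t
      = (s - t) * (exp ((1 - \<alpha>) / 2 * z) * (emb (-\<alpha>) z - emb (-\<alpha>) t))"
    using MVT2[OF True DERIV_pointwise_divergence] by blast
  then show ?thesis
    using True strict_monoD[OF emb_strict_mono z(1), of "-\<alpha>"] by simp
next
  case False
  then have "s < t" using assms by simp
  from MVT2[OF this DERIV_pointwise_divergence] obtain z where z: "z < t" "pointwise_divergence \<alpha> t t - pointwise_divergence \<alpha> s t
      = (t - s) * (exp ((1 - \<alpha>) / 2 * z) * (emb (-\<alpha>) z - emb (-\<alpha>) t))" by blast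
  have "(t - s) * (exp ((1 - \<alpha>) / 2 * z) * (emb (-\<alpha>) z - emb (-\<alpha>) t)) < 0"
    using \<open>s < t\<close> strict_monoD[OF emb_strict_mono z(1), of "-\<alpha>"] by (intro mult_pos_neg) auto
  then show ?thesis using z(2) by simp
qed

lemma pointwise_divergence_nonneg: "0 \<le> pointwise_divergence \<alpha> s t"
  using pointwise_divergence_pos[of s t \<alpha>] by (cases "s = t") auto

lemma pointwise_divergence_eq_0_iff: "pointwise_divergence \<alpha> s t = 0 \<longleftrightarrow> s = t"
  using pointwise_divergence_pos[of s t \<alpha>] by (cases "s = t") auto

text \<open>
  The transition from the coordinate \<open>\<alpha>\<close> to the coordinate \<open>-\<alpha>\<close>. Its derivative is the ratio of
  \<open>exp ((1 + \<alpha>) / 2 * t)\<close> and \<open>exp ((1 - \<alpha>) / 2 * t)\<close> at \<open>t = emb_inv \<alpha> y\<close>, and it is the weight in the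
  second derivative of the divergence.
\<close>

lemma DERIV_emb_minus_emb_inv:
  assumes "0 < 1 + (1 - \<alpha>) / 2 * y"
  shows "((\<lambda>y. emb (-\<alpha>) (emb_inv \<alpha> y)) has_real_derivative exp (\<alpha> * emb_inv \<alpha> y)) (at y)"
proof -
  have "exp ((1 - -\<alpha>) / 2 * emb_inv \<alpha> y) * inverse (1 + (1 - \<alpha>) / 2 * y) = exp (\<alpha> * emb_inv \<alpha> y)"
    unfolding exp_emb_inv[OF assms, symmetric] exp_minus[symmetric] exp_add[symmetric]
    by (simp add: field_simps)
  with DERIV_chain2[OF DERIV_emb[of "-\<alpha>"] DERIV_emb_inv[OF assms]] show ?thesis by simp
qed

text \<open>
  The derivative is uniformly continuous on a compact interval, so the mean value theorem makes the
  remainder uniformly small. Uniformity in \<open>y\<close> is what differentiability of the induced map of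
  functions in the supremum norm requires.
\<close>

lemma emb_minus_emb_inv_uniformly_differentiable:
  fixes l r :: real
  assumes K: "\<And>y. y \<in> {l..r} \<Longrightarrow> 0 < 1 + (1 - \<alpha>) / 2 * y" and "\<epsilon> > 0"
  obtains \<delta> where "\<delta> > 0" "\<And>y h. y \<in> {l..r} \<Longrightarrow> \<bar>h\<bar> < \<delta> \<Longrightarrow> y + h \<in> {l..r} \<Longrightarrow>
    \<bar>emb (-\<alpha>) (emb_inv \<alpha> (y + h)) - emb (-\<alpha>) (emb_inv \<alpha> y) - exp (\<alpha> * emb_inv \<alpha> y) * h\<bar> \<le> \<epsilon> * \<bar>h\<bar>"
proof -
  let ?g = "\<lambda>y. emb (-\<alpha>) (emb_inv \<alpha> y)" and ?g' = "\<lambda>y. exp (\<alpha> * emb_inv \<alpha> y)"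
  have "continuous_on {l..r} (emb_inv \<alpha>)"
    by (intro continuous_at_imp_continuous_on ballI DERIV_isCont[OF DERIV_emb_inv] K)
  then have "continuous_on {l..r} ?g'" by (intro continuous_intros)
  then have "uniformly_continuous_on {l..r} ?g'"
    by (rule compact_uniformly_continuous) simp
  then obtain \<delta> where \<delta>: "\<delta> > 0" "\<And>y z. y \<in> {l..r} \<Longrightarrow> z \<in> {l..r} \<Longrightarrow> dist z y < \<delta> \<Longrightarrow> dist (?g' z) (?g' y) < \<epsilon>"
    unfolding uniformly_continuous_on_def using \<open>\<epsilon> > 0\<close> by metis
  have "\<bar>?g (y + h) - ?g y - ?g' y * h\<bar> \<le> \<epsilon> * \<bar>h\<bar>"
    if y: "y \<in> {l..r}" and h: "\<bar>h\<bar> < \<delta>" and yh: "y + h \<in> {l..r}" for y h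
  proof -
    have "\<exists>z. z \<in> {l..r} \<and> \<bar>z - y\<bar> \<le> \<bar>h\<bar> \<and> ?g (y + h) - ?g y = h * ?g' z"
    proof (cases h "0 :: real" rule: linorder_cases)
      case greater
      then have "y < y + h" by simp
      moreover have "DERIV ?g x :> ?g' x" if "y \<le> x" "x \<le> y + h" for x
        using that y yh by (intro DERIV_emb_minus_emb_inv K) auto
      ultimately obtain z where "y < z" "z < y + h" "?g (y + h) - ?g y = (y + h - y) * ?g' z"
        using MVT2[of y "y + h" ?g ?g'] by blast
      then show ?thesis using y yh by (intro exI[of _ z]) auto
    next
      case less
      then have "y + h < y" by simp
      moreover have "DERIV ?g x :> ?g' x" if "y + h \<le> x" "x \<le> y" for x
        using that y yh by (intro DERIV_emb_minus_emb_inv K) auto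
      ultimately obtain z where "y + h < z" "z < y" "?g y - ?g (y + h) = (y - (y + h)) * ?g' z"
        using MVT2[of "y + h" y ?g ?g'] by blast
      then show ?thesis using y yh by (intro exI[of _ z]) auto
    qed (use y in auto)
    then obtain z where z: "z \<in> {l..r}" "\<bar>z - y\<bar> \<le> \<bar>h\<bar>" "?g (y + h) - ?g y = h * ?g' z" by blast
    have "\<bar>?g (y + h) - ?g y - ?g' y * h\<bar> = \<bar>?g' z - ?g' y\<bar> * \<bar>h\<bar>"
      unfolding z(3) by (simp add: algebra_simps flip: abs_mult)
    also have "\<dots> \<le> \<epsilon> * \<bar>h\<bar>"
      using \<delta>(2)[OF y z(1)] z(2) h by (intro mult_right_mono) (auto simp: dist_real_def)
    finally show ?thesis .
  qed
  with \<delta>(1) show ?thesis by (rule that)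
qed

lemma bounded_image_interval:
  assumes "bounded (a ` B)"
  obtains R :: real where "R > 0" "\<And>x. x \<in> B \<Longrightarrow> \<bar>a x\<bar> \<le> R"
  using assms unfolding bounded_pos by auto

text \<open>
  In this lemma and the next, the composition vanishes off \<open>B\<close> because the scalar function vanishes
  at \<open>0\<close>.
\<close>

lemma Cbk_emb:
  assumes "open B" "a \<in> Cbk k B"
  shows "(\<lambda>x. emb \<alpha> (a x)) \<in> Cbk k B"
proof -
  obtain R where R: "R > 0" "\<And>x. x \<in> B \<Longrightarrow> \<bar>a x\<bar> \<le> R"
    using bounded_image_interval[OF CbkD(3)[OF assms(2)]] by blast
  \<comment> \<open>The derivatives of \<open>emb \<alpha>\<close>; for \<open>\<alpha> = 1\<close> the convention \<open>0 ^ 0 = 1\<close> gives \<open>1, 0, 0, \<dots>\<close>.\<close>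
  define f where "f n = (case n of 0 \<Rightarrow> emb \<alpha>
    | Suc m \<Rightarrow> \<lambda>t. ((1 - \<alpha>) / 2) ^ m * exp ((1 - \<alpha>) / 2 * t))" for n
  have "(\<lambda>x. f 0 (a x)) \<in> Cbk k B"
  proof (rule Cbk_compose[OF assms])
    show "compact {-R..R}" "a ` B \<subseteq> {-R..R}" "f 0 0 = 0"
      using R(2) by (auto simp: f_def abs_le_iff minus_le_iff)
    show "(f n has_real_derivative f (Suc n) t) (at t)" for n t
    proof (cases n)
      case (Suc m)
      then show ?thesis by (auto simp: f_def intro!: derivative_eq_intros)
    qed (simp add: f_def DERIV_emb del: times_divide_eq_left)
  qed
  then show ?thesis by (simp add: f_def)
qed

lemma Cbk_emb_inv:
  assumes "open B" "b \<in> Cbk k B" and "\<delta> > 0" and \<delta>: "\<And>x. x \<in> B \<Longrightarrow> \<delta> \<le> 1 + (1 - \<alpha>) / 2 * b x"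
  shows "(\<lambda>x. emb_inv \<alpha> (b x)) \<in> Cbk k B"
proof -
  obtain R where R: "R > 0" "\<And>x. x \<in> B \<Longrightarrow> \<bar>b x\<bar> \<le> R"
    using bounded_image_interval[OF CbkD(3)[OF assms(2)]] by blast
  define \<beta> where "\<beta> = (1 - \<alpha>) / 2"
  define f where "f n = (case n of 0 \<Rightarrow> emb_inv \<alpha>
    | Suc m \<Rightarrow> \<lambda>y. fact m * (-\<beta>) ^ m * inverse (1 + \<beta> * y) ^ Suc m)" for n
  \<comment> \<open>The uniform lower bound \<open>\<delta>\<close> keeps the range of \<open>b\<close> inside a compact part of the half line on
    which \<open>emb_inv \<alpha>\<close> is smooth.\<close>
  define K where "K = {-R..R} \<inter> {y. \<delta> \<le> 1 + \<beta> * y}"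
  have "(\<lambda>x. f 0 (b x)) \<in> Cbk k B"
  proof (rule Cbk_compose[OF assms(1,2)])
    have "closed {y. \<delta> \<le> 1 + \<beta> * y}"
      by (intro closed_Collect_le continuous_intros)
    then show "compact K" unfolding K_def by (intro compact_Int_closed) auto
    show "b ` B \<subseteq> K" "f 0 0 = 0"
      using R(2) \<delta> by (auto simp: f_def abs_le_iff minus_le_iff K_def \<beta>_def)
    show "(f n has_real_derivative f (Suc n) t) (at t)" if "t \<in> K" for n t
    proof (cases n)
      case 0
      then show ?thesis
        using DERIV_emb_inv[of \<alpha> t] that \<open>\<delta> > 0\<close> by (simp add: f_def K_def \<beta>_def)
    next
      case (Suc m)
      have pos: "1 + \<beta> * t \<noteq> 0" using that \<open>\<delta> > 0\<close> by (auto simp: K_def)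
      have "((\<lambda>y. inverse (1 + \<beta> * y)) has_real_derivative - (inverse (1 + \<beta> * t) * \<beta> * inverse (1 + \<beta> * t))) (at t)"
        using pos by (auto intro!: derivative_eq_intros)
      from DERIV_cmult[OF DERIV_power_Suc[OF this, of m], of "fact m * (-\<beta>) ^ m"]
      show ?thesis by (simp add: f_def Suc algebra_simps)
    qed
  qed
  then show ?thesis by (simp add: f_def)
qed

lemma Cbk_scaleR:
  assumes "open B" "a \<in> Cbk k B"
  shows "c *\<^sub>R a \<in> Cbk k B"
proof -
  obtain R where R: "R > 0" "\<And>x. x \<in> B \<Longrightarrow> \<bar>a x\<bar> \<le> R"
    using bounded_image_interval[OF CbkD(3)[OF assms(2)]] by blast
  define f where "f n = (case n of 0 \<Rightarrow> (\<lambda>t. c * t) | Suc m \<Rightarrow> (\<lambda>_. if m = 0 then c else 0))" for n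
  have "(\<lambda>x. f 0 (a x)) \<in> Cbk k B"
  proof (rule Cbk_compose[OF assms])
    show "compact {-R..R}" "a ` B \<subseteq> {-R..R}" "f 0 0 = 0"
      using R(2) by (auto simp: f_def abs_le_iff minus_le_iff)
    show "(f n has_real_derivative f (Suc n) t) (at t)" for n t
      by (cases n) (auto simp: f_def intro!: derivative_eq_intros)
  qed
  then show ?thesis by (simp add: f_def scaleR_fun_def)
qed

section \<open>The reference measure and log densities\<close>

locale reference_measure = prob_space \<mu>
  for \<mu> :: "'a::real_normed_vector measure" +
  fixes B :: "'a set" and k :: nat
  assumes open_B: "open B"
    and sets_eq: "sets \<mu> = sets (restrict_space borel B)"
    and full_support: "\<And>A. A \<in> sets \<mu> \<Longrightarrow> open A \<Longrightarrow> A \<noteq> {} \<Longrightarrow> measure \<mu> A > 0"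
begin

abbreviation "G \<equiv> Cbk k B"
abbreviation "N \<equiv> Cbk_norm k B"
abbreviation "M \<equiv> M_set k B \<mu>"
abbreviation "\<phi> \<equiv> phi k B \<mu>"
abbreviation "\<phi>inv \<equiv> phi_inv k B \<mu>"
abbreviation "D \<equiv> divergence k B \<mu>"

lemma space_eq: "space \<mu> = B"
  using sets_eq_imp_space_eq[OF sets_eq] by (simp add: space_restrict_space)

lemma B_nonempty: "B \<noteq> {}"
  using not_empty by (simp add: space_eq)

definition bcont :: "('a \<Rightarrow> real) \<Rightarrow> bool" where
  "bcont f \<longleftrightarrow> continuous_on B f \<and> bounded (f ` B)"

lemma bcontD:
  assumes "bcont f"
  obtains R where "R > 0" "\<And>x. x \<in> B \<Longrightarrow> \<bar>f x\<bar> \<le> R"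
  using assms bounded_image_interval unfolding bcont_def by blast

lemma bcontI: "continuous_on B f \<Longrightarrow> (\<And>x. x \<in> B \<Longrightarrow> \<bar>f x\<bar> \<le> R) \<Longrightarrow> bcont f"
  unfolding bcont_def bounded_iff by auto

lemma bcont_const [intro]: "bcont (\<lambda>_. c)"
  by (rule bcontI[where R = "\<bar>c\<bar>"]) auto

lemma bcont_add [intro]: "bcont f \<Longrightarrow> bcont g \<Longrightarrow> bcont (\<lambda>x. f x + g x)"
  unfolding bcont_def by (auto intro: continuous_on_add bounded_plus_comp)

lemma bcont_diff [intro]: "bcont f \<Longrightarrow> bcont g \<Longrightarrow> bcont (\<lambda>x. f x - g x)"
  unfolding bcont_def by (auto intro: continuous_on_diff bounded_minus_comp)

lemma bcont_mult [intro]: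
  assumes f: "bcont f" and g: "bcont g"
  shows "bcont (\<lambda>x. f x * g x)"
proof -
  obtain R S where R: "R > 0" "\<And>x. x \<in> B \<Longrightarrow> \<bar>f x\<bar> \<le> R" and S: "S > 0" "\<And>x. x \<in> B \<Longrightarrow> \<bar>g x\<bar> \<le> S"
    using bcontD[OF f] bcontD[OF g] by metis
  show ?thesis
  proof (rule bcontI[where R = "R * S"])
    show "\<bar>f x * g x\<bar> \<le> R * S" if "x \<in> B" for x
      using R S that unfolding abs_mult by (intro mult_mono) auto
  qed (use f g in \<open>auto simp: bcont_def intro: continuous_on_mult\<close>)
qed

lemma bcont_exp [intro]:
  assumes "bcont f"
  shows "bcont (\<lambda>x. exp (f x))"
proof -
  obtain R where R: "R > 0" "\<And>x. x \<in> B \<Longrightarrow> \<bar>f x\<bar> \<le> R" using bcontD[OF assms] by blast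
  show ?thesis
  proof (rule bcontI[where R = "exp R"])
    show "\<bar>exp (f x)\<bar> \<le> exp R" if "x \<in> B" for x
      using R(2)[OF that] by simp
  qed (use assms in \<open>auto simp: bcont_def intro: continuous_on_exp\<close>)
qed

lemma G_bcont: "a \<in> G \<Longrightarrow> bcont a"
  unfolding bcont_def using CbkD(2,3) by blast

lemma bcont_measurable: "bcont f \<Longrightarrow> f \<in> borel_measurable \<mu>"
  using borel_measurable_continuous_on_restrict[of B f] measurable_cong_sets[OF sets_eq refl]
  unfolding bcont_def by blast

lemma bcont_integrable:
  assumes "bcont f"
  shows "integrable \<mu> f"
proof -
  obtain R where R: "R > 0" "\<And>x. x \<in> B \<Longrightarrow> \<bar>f x\<bar> \<le> R" using bcontD[OF assms] by blast
  show ?thesis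
    using R by (intro integrable_const_bound[of _ R] bcont_measurable assms) (auto simp: space_eq)
qed

lemma integral_abs_le:
  assumes "bcont f" and "\<And>x. x \<in> B \<Longrightarrow> \<bar>f x\<bar> \<le> c"
  shows "\<bar>integral\<^sup>L \<mu> f\<bar> \<le> c"
proof -
  have "\<bar>integral\<^sup>L \<mu> f\<bar> \<le> (\<integral>x. \<bar>f x\<bar> \<partial>\<mu>)" by (rule integral_abs_bound)
  also have "\<dots> \<le> (\<integral>x. c \<partial>\<mu>)"
    using assms bcont_integrable[OF assms(1)]
    by (intro integral_mono integrable_abs) (auto simp: space_eq)
  finally show ?thesis by (simp add: prob_space)
qed

text \<open>
  The set where \<open>f\<close> does not vanish is open, and non-empty open sets have positive measure. This
  makes the continuous version of a density unique and turns vanishing divergence into equality.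
\<close>

lemma AE_zero_imp_zero:
  assumes f: "continuous_on B f" and ae: "AE x in \<mu>. f x = (0::real)" and x: "x \<in> B"
  shows "f x = 0"
proof (rule ccontr)
  assume "f x \<noteq> 0"
  define A where "A = B \<inter> f -` (- {0})"
  have "open A" unfolding A_def by (rule continuous_open_preimage[OF f open_B]) auto
  moreover have "A \<in> sets \<mu>"
    using \<open>open A\<close> unfolding sets_eq sets_restrict_space by (intro image_eqI[of _ _ A]) (auto simp: A_def)
  moreover have "A \<noteq> {}" using \<open>f x \<noteq> 0\<close> x by (auto simp: A_def)
  ultimately have "measure \<mu> A > 0" using full_support by blast
  moreover have "{x \<in> space \<mu>. \<not> f x = 0} = A" by (auto simp: A_def space_eq)
  then have "emeasure \<mu> A = 0" using AE_iff_measurable[OF \<open>A \<in> sets \<mu>\<close>, of "\<lambda>x. f x = 0"] ae by simp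
  ultimately show False by (simp add: measure_def)
qed

lemma integral_eq_0_imp_zero:
  assumes f: "bcont f" and "\<And>x. 0 \<le> f x" and "integral\<^sup>L \<mu> f = 0" and x: "x \<in> B"
  shows "f x = 0"
proof (rule AE_zero_imp_zero[OF _ _ x])
  show "continuous_on B f" using f by (simp add: bcont_def)
  show "AE x in \<mu>. f x = 0"
    using assms integral_nonneg_eq_0_iff_AE[OF bcont_integrable[OF f]] by simp
qed

text \<open>
  This is the inverse of \<open>\<phi> 1\<close>: it identifies \<open>M\<close> with \<open>G\<close>.
\<close>

definition from_log_density :: "('a \<Rightarrow> real) \<Rightarrow> 'a measure" where
  "from_log_density a = density \<mu> (\<lambda>x. ennreal (exp_G a x))"

lemma exp_G_measurable: "a \<in> G \<Longrightarrow> (\<lambda>x. ennreal (exp_G a x)) \<in> borel_measurable \<mu>"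
  using bcont_measurable[OF bcont_exp[OF G_bcont]] by (simp add: exp_G_def)

lemma from_log_density_in_M:
  assumes a: "a \<in> G"
  shows "from_log_density a \<in> M"
proof -
  note meas = exp_G_measurable[OF a]
  have "finite_measure (from_log_density a)"
  proof (rule finite_measureI)
    have "emeasure (from_log_density a) (space (from_log_density a)) = (\<integral>\<^sup>+x. ennreal (exp_G a x) \<partial>\<mu>)"
      unfolding from_log_density_def using meas by (simp add: emeasure_density cong: nn_integral_cong)
    also have "\<dots> = ennreal (\<integral>x. exp_G a x \<partial>\<mu>)"
      using bcont_integrable[OF bcont_exp[OF G_bcont[OF a]]]
      by (intro nn_integral_eq_integral) (auto simp: exp_G_def)
    finally show "emeasure (from_log_density a) (space (from_log_density a)) \<noteq> \<infinity>" by simp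
  qed
  moreover have "absolutely_continuous \<mu> (from_log_density a)"
    unfolding from_log_density_def by (rule absolutely_continuousI_density[OF meas])
  moreover have "absolutely_continuous (from_log_density a) \<mu>"
    unfolding absolutely_continuous_def
  proof
    fix A assume "A \<in> null_sets (from_log_density a)"
    then have "A \<in> sets \<mu>" "AE x in \<mu>. x \<notin> A"
      unfolding from_log_density_def null_sets_density_iff[OF meas] by (auto simp: exp_G_def)
    then show "A \<in> null_sets \<mu>" by (simp add: AE_iff_null_sets)
  qed
  ultimately show ?thesis
    unfolding M_set_def from_log_density_def using a by auto
qed

lemma from_log_density_inject:
  assumes a: "a \<in> G" and b: "b \<in> G" and eq: "from_log_density a = from_log_density b"
  shows "a = b"
proof
  fix x
  show "a x = b x"
  proof (cases "x \<in> B")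
    case True
    have "AE x in \<mu>. ennreal (exp_G a x) = ennreal (exp_G b x)"
      using eq density_unique_iff[OF exp_G_measurable[OF a] exp_G_measurable[OF b]] by (simp add: from_log_density_def)
    then have "AE x in \<mu>. a x - b x = 0" by (simp add: exp_G_def)
    moreover have "continuous_on B (\<lambda>x. a x - b x)"
      using bcont_diff[OF G_bcont[OF a] G_bcont[OF b]] by (simp add: bcont_def)
    ultimately have "a x - b x = 0" using AE_zero_imp_zero True by blast
    then show ?thesis by simp
  next
    case False
    then show ?thesis using CbkD(1)[OF a] CbkD(1)[OF b] by simp
  qed
qed

lemma dens_from_log_density:
  assumes a: "a \<in> G"
  shows "dens k B \<mu> (from_log_density a) = exp_G a"
  unfolding dens_def
proof (rule the_equality)
  show "exp_G a \<in> exp_G ` G \<and> from_log_density a = density \<mu> (\<lambda>x. ennreal (exp_G a x))"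
    using a by (simp add: from_log_density_def)
  fix p assume "p \<in> exp_G ` G \<and> from_log_density a = density \<mu> (\<lambda>x. ennreal (p x))"
  then obtain b where "b \<in> G" "p = exp_G b" "from_log_density a = from_log_density b" by (auto simp: from_log_density_def)
  then show "p = exp_G a" using from_log_density_inject[OF a] by blast
qed

lemma phi_from_log_density:
  assumes a: "a \<in> G"
  shows "\<phi> \<alpha> (from_log_density a) = (\<lambda>x. emb \<alpha> (a x))"
  unfolding phi_def dens_from_log_density[OF a] by (simp add: exp_G_def emb_def fun_eq_iff)

lemma phi_1_from_log_density: "a \<in> G \<Longrightarrow> \<phi> 1 (from_log_density a) = a"
  by (simp add: phi_from_log_density)

lemma M_eq: "M = from_log_density ` G"
proof
  show "from_log_density ` G \<subseteq> M" using from_log_density_in_M by blast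
  show "M \<subseteq> from_log_density ` G" unfolding M_set_def from_log_density_def by auto
qed

lemma phi_1_in_G: "P \<in> M \<Longrightarrow> \<phi> 1 P \<in> G" and from_log_density_phi_1: "P \<in> M \<Longrightarrow> from_log_density (\<phi> 1 P) = P"
  by (auto simp: M_eq phi_1_from_log_density)

lemma phi_eq: "P \<in> M \<Longrightarrow> \<phi> \<alpha> P x = emb \<alpha> (\<phi> 1 P x)"
  using phi_from_log_density[OF phi_1_in_G, of P \<alpha>] by (simp add: from_log_density_phi_1)

lemma phi_in_G: "P \<in> M \<Longrightarrow> \<phi> \<alpha> P \<in> G"
  using Cbk_emb[OF open_B phi_1_in_G, of P \<alpha>] by (simp flip: phi_eq)

lemma phi_1_eq: "P \<in> M \<Longrightarrow> \<phi> 1 P x = emb_inv \<alpha> (\<phi> \<alpha> P x)"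
  by (simp add: phi_eq[of P \<alpha>])

lemma phi_inj_on: "inj_on (\<phi> \<alpha>) M"
proof (rule inj_onI)
  fix P Q assume P: "P \<in> M" and Q: "Q \<in> M" and eq: "\<phi> \<alpha> P = \<phi> \<alpha> Q"
  have "\<phi> 1 P = \<phi> 1 Q"
  proof
    show "\<phi> 1 P x = \<phi> 1 Q x" for x
      using phi_1_eq[OF P, where \<alpha> = \<alpha> and x = x] phi_1_eq[OF Q, where \<alpha> = \<alpha> and x = x] eq by metis
  qed
  then show "P = Q" using from_log_density_phi_1[OF P] from_log_density_phi_1[OF Q] by metis
qed

lemma phi_inv_phi [simp]: "P \<in> M \<Longrightarrow> \<phi>inv \<alpha> (\<phi> \<alpha> P) = P"
  unfolding phi_inv_def by (simp add: inv_into_f_f phi_inj_on)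

text \<open>
  Members of the image are bounded away from the end of the half line because log densities are
  bounded. Conversely such a bound lets \<^const>\<open>emb_inv\<close> be applied inside \<open>G\<close>. The description shows
  that the image is convex and open.
\<close>

lemma phi_image_iff:
  "b \<in> \<phi> \<alpha> ` M \<longleftrightarrow> b \<in> G \<and> (\<exists>\<delta>>0. \<forall>x\<in>B. \<delta> \<le> 1 + (1 - \<alpha>) / 2 * b x)"
proof safe
  fix P assume P: "P \<in> M"
  then show "\<phi> \<alpha> P \<in> G" by (rule phi_in_G)
  obtain R where R: "R > 0" "\<And>x. x \<in> B \<Longrightarrow> \<bar>(1 - \<alpha>) / 2 * \<phi> 1 P x\<bar> \<le> R"
    using bcontD[OF bcont_mult[OF bcont_const G_bcont[OF phi_1_in_G[OF P]]]] by blast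
  have "exp (- R) \<le> 1 + (1 - \<alpha>) / 2 * \<phi> \<alpha> P x" if "x \<in> B" for x
    using R(2)[OF that] unfolding phi_eq[OF P, of \<alpha>] one_plus_emb by simp
  then show "\<exists>\<delta>>0. \<forall>x\<in>B. \<delta> \<le> 1 + (1 - \<alpha>) / 2 * \<phi> \<alpha> P x"
    using exp_gt_zero by blast
next
  fix \<delta> :: real assume b: "b \<in> G" and \<delta>: "\<delta> > 0" "\<forall>x\<in>B. \<delta> \<le> 1 + (1 - \<alpha>) / 2 * b x"
  define a where "a = (\<lambda>x. emb_inv \<alpha> (b x))"
  have a: "a \<in> G" unfolding a_def using \<delta> by (intro Cbk_emb_inv[OF open_B b \<delta>(1)]) auto
  have "emb \<alpha> (a x) = b x" for x
  proof (cases "x \<in> B")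
    case True
    then have "0 < 1 + (1 - \<alpha>) / 2 * b x" using \<delta> by force
    then show ?thesis by (simp only: a_def emb_emb_inv)
  next
    case False
    then show ?thesis using CbkD(1)[OF b] by (simp add: a_def)
  qed
  then have "\<phi> \<alpha> (from_log_density a) = b" by (simp add: phi_from_log_density[OF a])
  then show "b \<in> \<phi> \<alpha> ` M" using from_log_density_in_M[OF a] by blast
qed

lemma convex_phi_image: "convex (\<phi> \<alpha> ` M)"
proof (rule convexI)
  fix a b and u v :: real
  assume a: "a \<in> \<phi> \<alpha> ` M" and b: "b \<in> \<phi> \<alpha> ` M" and uv: "0 \<le> u" "0 \<le> v" "u + v = 1"
  obtain \<delta>1 where 1: "\<delta>1 > 0" "\<And>x. x \<in> B \<Longrightarrow> \<delta>1 \<le> 1 + (1 - \<alpha>) / 2 * a x" using a phi_image_iff by metis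
  obtain \<delta>2 where 2: "\<delta>2 > 0" "\<And>x. x \<in> B \<Longrightarrow> \<delta>2 \<le> 1 + (1 - \<alpha>) / 2 * b x" using b phi_image_iff by metis
  show "u *\<^sub>R a + v *\<^sub>R b \<in> \<phi> \<alpha> ` M"
    unfolding phi_image_iff
  proof (intro conjI exI ballI)
    show "u *\<^sub>R a + v *\<^sub>R b \<in> G"
      using a b by (intro Cbk_add Cbk_scaleR open_B) (auto simp: phi_image_iff)
    show "0 < min \<delta>1 \<delta>2" using 1 2 by simp
    fix x assume x: "x \<in> B"
    have "min \<delta>1 \<delta>2 = u * min \<delta>1 \<delta>2 + v * min \<delta>1 \<delta>2" using uv(3) by (metis distrib_right mult_1)
    also have "\<dots> \<le> u * (1 + (1 - \<alpha>) / 2 * a x) + v * (1 + (1 - \<alpha>) / 2 * b x)"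
      using 1(2)[OF x] 2(2)[OF x] uv by (intro add_mono mult_left_mono) auto
    also have "\<dots> = (u + v) + (1 - \<alpha>) / 2 * (u * a x + v * b x)" by algebra
    finally show "min \<delta>1 \<delta>2 \<le> 1 + (1 - \<alpha>) / 2 * (u *\<^sub>R a + v *\<^sub>R b) x"
      by (simp add: uv(3))
  qed
qed

lemma phi_bcont: "P \<in> M \<Longrightarrow> bcont (\<phi> \<alpha> P)"
  using G_bcont phi_in_G by blast

section \<open>Divergences as integrals\<close>

lemma bcont_pointwise_divergence:
  assumes P: "P \<in> M" and Q: "Q \<in> M"
  shows "bcont (\<lambda>x. pointwise_divergence \<alpha> (\<phi> 1 P x) (\<phi> 1 Q x))"
proof -
  have "bcont (\<lambda>x. emb \<beta> (\<phi> 1 P x))" "bcont (\<lambda>x. emb \<beta> (\<phi> 1 Q x))" for \<beta>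
    using phi_bcont[OF P, of \<beta>] phi_bcont[OF Q, of \<beta>] phi_eq[OF P, of \<beta>, symmetric] phi_eq[OF Q, of \<beta>, symmetric]
    by simp_all
  note bc = this phi_bcont[OF P, of 1] phi_bcont[OF Q, of 1]
  have "bcont (\<lambda>x. 2 / (1 + \<alpha>) * (emb (-1) (\<phi> 1 P x) - emb \<alpha> (\<phi> 1 P x))
      + 2 / (1 - \<alpha>) * (emb (-1) (\<phi> 1 Q x) - emb (-\<alpha>) (\<phi> 1 Q x))
      - emb \<alpha> (\<phi> 1 P x) * emb (-\<alpha>) (\<phi> 1 Q x))"
    by (intro bcont_diff bcont_add bcont_mult bcont_const bc)
  moreover have "bcont (\<lambda>x. emb (-1) (\<phi> 1 Q x) - emb (-1) (\<phi> 1 P x) + (emb (-1) (\<phi> 1 P x) + 1) * (\<phi> 1 P x - \<phi> 1 Q x))"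
    "bcont (\<lambda>x. emb (-1) (\<phi> 1 P x) - emb (-1) (\<phi> 1 Q x) + (emb (-1) (\<phi> 1 Q x) + 1) * (\<phi> 1 Q x - \<phi> 1 P x))"
    by (intro bcont_diff bcont_add bcont_mult bcont_const bc)+
  ultimately show ?thesis
    unfolding pointwise_divergence_def by (cases "\<alpha> = 1"; cases "\<alpha> = -1") simp_all
qed

text \<open>
  Each separate integral in the definition has a bounded continuous integrand, so they combine
  into one. Identities and inequalities for the scalar divergence can then be integrated.
\<close>

lemma divergence_eq:
  assumes P: "P \<in> M" and Q: "Q \<in> M"
  shows "D \<alpha> P Q = (\<integral>x. pointwise_divergence \<alpha> (\<phi> 1 P x) (\<phi> 1 Q x) \<partial>\<mu>)"
proof -
  have m1: "divergence_m1 k B \<mu> P Q = (\<integral>x. emb (-1) (\<phi> 1 Q x) - emb (-1) (\<phi> 1 P x) +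
      (emb (-1) (\<phi> 1 P x) + 1) * (\<phi> 1 P x - \<phi> 1 Q x) \<partial>\<mu>)" if P: "P \<in> M" and Q: "Q \<in> M" for P Q
  proof -
    have "bcont (\<lambda>x. \<phi> (-1) Q x - \<phi> (-1) P x)" "bcont (\<lambda>x. (\<phi> (-1) P x + 1) * (\<phi> 1 P x - \<phi> 1 Q x))"
      using phi_bcont[OF P] phi_bcont[OF Q] by (auto intro!: bcont_mult)
    note this[THEN bcont_integrable]
    from Bochner_Integration.integral_add[OF this] show ?thesis
      unfolding phi_eq[OF P, of "-1", symmetric] phi_eq[OF Q, of "-1", symmetric]
      by (simp add: divergence_m1_def ip_def fun_diff_def plus_fun_def one_fun_def)
  qed
  consider "\<alpha> = -1" | "\<alpha> = 1" | "\<alpha> \<noteq> 1" "\<alpha> \<noteq> -1" by blast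
  then show ?thesis
  proof cases
    case 1
    then show ?thesis using m1[OF P Q] by (simp add: divergence_def pointwise_divergence_def)
  next
    case 2
    then show ?thesis using m1[OF Q P] by (simp add: divergence_def pointwise_divergence_def)
  next
    case 3
    have i: "integrable \<mu> (\<lambda>x. \<phi> (-1) P x - \<phi> \<alpha> P x)" "integrable \<mu> (\<lambda>x. \<phi> (-1) Q x - \<phi> (-\<alpha>) Q x)"
      "integrable \<mu> (\<lambda>x. \<phi> \<alpha> P x * \<phi> (-\<alpha>) Q x)"
      by (intro bcont_integrable bcont_mult bcont_diff phi_bcont P Q)+
    have lin: "(\<integral>x. u * f x + v * g x - h x \<partial>\<mu>) = u * (\<integral>x. f x \<partial>\<mu>) + v * (\<integral>x. g x \<partial>\<mu>) - (\<integral>x. h x \<partial>\<mu>)"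
      if "integrable \<mu> f" "integrable \<mu> g" "integrable \<mu> h" for u v and f g h :: "'a \<Rightarrow> real"
      using that by simp
    have "(\<integral>x. pointwise_divergence \<alpha> (\<phi> 1 P x) (\<phi> 1 Q x) \<partial>\<mu>) =
        (\<integral>x. 2 / (1 + \<alpha>) * (\<phi> (-1) P x - \<phi> \<alpha> P x) + 2 / (1 - \<alpha>) * (\<phi> (-1) Q x - \<phi> (-\<alpha>) Q x)
           - \<phi> \<alpha> P x * \<phi> (-\<alpha>) Q x \<partial>\<mu>)"
      using 3 unfolding phi_eq[OF P, of "-1"] phi_eq[OF P, of \<alpha>] phi_eq[OF Q, of "-1"] phi_eq[OF Q, of "-\<alpha>"]
      by (simp add: pointwise_divergence_def)
    also have "\<dots> = D \<alpha> P Q"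
      unfolding lin[OF i] using 3 by (simp add: divergence_def ip_def fun_diff_def)
    finally show ?thesis by simp
  qed
qed

lemma divergence_minus: "P \<in> M \<Longrightarrow> Q \<in> M \<Longrightarrow> D (-\<alpha>) P Q = D \<alpha> Q P"
  by (simp add: divergence_eq pointwise_divergence_minus)

lemma divergence_nonneg: "P \<in> M \<Longrightarrow> Q \<in> M \<Longrightarrow> 0 \<le> D \<alpha> P Q"
  by (simp add: divergence_eq pointwise_divergence_nonneg)

lemma divergence_eq_0_iff:
  assumes P: "P \<in> M" and Q: "Q \<in> M"
  shows "D \<alpha> P Q = 0 \<longleftrightarrow> P = Q"
proof
  assume "P = Q"
  then show "D \<alpha> P Q = 0" using P by (simp add: divergence_eq)
next
  assume "D \<alpha> P Q = 0"
  then have "pointwise_divergence \<alpha> (\<phi> 1 P x) (\<phi> 1 Q x) = 0" if "x \<in> B" for x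
    using integral_eq_0_imp_zero[OF bcont_pointwise_divergence[OF P Q] pointwise_divergence_nonneg _ that] divergence_eq[OF P Q] by simp
  then have "\<phi> 1 P x = \<phi> 1 Q x" for x
    using CbkD(1)[OF phi_1_in_G[OF P]] CbkD(1)[OF phi_1_in_G[OF Q]] by (cases "x \<in> B") (auto simp: pointwise_divergence_eq_0_iff)
  then show "P = Q" using from_log_density_phi_1[OF P] from_log_density_phi_1[OF Q] by (metis ext)
qed

lemma divergence_pos: "P \<in> M \<Longrightarrow> Q \<in> M \<Longrightarrow> P \<noteq> Q \<Longrightarrow> 0 < D \<alpha> P Q"
  using divergence_nonneg[of P Q \<alpha>] divergence_eq_0_iff[of P Q \<alpha>] by linarith

lemma divergence_three_point:
  assumes P: "P \<in> M" and Q: "Q \<in> M" and R: "R \<in> M"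
  shows "D \<alpha> P R = D \<alpha> P Q + D \<alpha> Q R - ip \<mu> (\<phi> \<alpha> P - \<phi> \<alpha> Q) (\<phi> (-\<alpha>) R - \<phi> (-\<alpha>) Q)"
proof -
  have "integrable \<mu> (\<lambda>x. (\<phi> \<alpha> P x - \<phi> \<alpha> Q x) * (\<phi> (-\<alpha>) R x - \<phi> (-\<alpha>) Q x))"
    by (intro bcont_integrable bcont_mult bcont_diff phi_bcont P Q R)
  moreover have "D \<alpha> P R = (\<integral>x. pointwise_divergence \<alpha> (\<phi> 1 P x) (\<phi> 1 Q x) + pointwise_divergence \<alpha> (\<phi> 1 Q x) (\<phi> 1 R x)
      - (\<phi> \<alpha> P x - \<phi> \<alpha> Q x) * (\<phi> (-\<alpha>) R x - \<phi> (-\<alpha>) Q x) \<partial>\<mu>)"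
    unfolding divergence_eq[OF P R] phi_eq[OF P, of \<alpha>] phi_eq[OF Q, of \<alpha>] phi_eq[OF Q, of "-\<alpha>"] phi_eq[OF R, of "-\<alpha>"]
      pointwise_divergence_three_point[symmetric] ..
  ultimately show ?thesis
    using bcont_pointwise_divergence[OF P Q, THEN bcont_integrable] bcont_pointwise_divergence[OF Q R, THEN bcont_integrable]
    by (simp add: divergence_eq[OF P Q] divergence_eq[OF Q R] ip_def)
qed

section \<open>Integral functionals on the model space\<close>

text \<open>
  The terms of higher order in the norm of \<open>G\<close> are nonnegative, so the norm dominates the supremum
  norm, in which the integrals below are estimated.
\<close>

lemma abs_le_norm:
  assumes a: "a \<in> G" and x: "x \<in> B"
  shows "\<bar>a x\<bar> \<le> N a"
proof -
  obtain R where "\<And>x. x \<in> B \<Longrightarrow> \<bar>a x\<bar> \<le> R" using bcontD[OF G_bcont[OF a]] by blast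
  then have "bdd_above ((\<lambda>x. \<bar>a x\<bar>) ` B)" by (auto simp: bdd_above_def)
  then have "\<bar>a x\<bar> \<le> (SUP x\<in>B. \<bar>a x\<bar>)" using x by (rule cSUP_upper2[where x = x]) simp
  moreover have "0 \<le> (SUP x\<in>B. mult_norm i (deriv_form a i x))" if "i \<in> {1..k}" for i
  proof -
    have "mult_norm i (deriv_form a i x) \<le> (SUP x\<in>B. mult_norm i (deriv_form a i x))"
      using that x CbkD(6)[OF a] by (intro cSUP_upper) auto
    moreover have "0 \<le> mult_norm i (deriv_form a i x)"
      using that x by (intro mult_norm_nonneg Cbk_deriv_form_mult_forms[OF a]) auto
    ultimately show ?thesis by linarith
  qed
  then have "0 \<le> (\<Sum>i=1..k. SUP x\<in>B. mult_norm i (deriv_form a i x))" by (rule sum_nonneg)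
  ultimately show ?thesis unfolding Cbk_norm_def by linarith
qed

lemma norm_nonneg: "a \<in> G \<Longrightarrow> 0 \<le> N a"
  using abs_le_norm B_nonempty by (metis abs_ge_zero ex_in_conv order_trans)

lemma norm_zero: "N 0 = 0"
proof -
  have "iter_deriv 0 us = (\<lambda>_. 0)" for us :: "'a list"
    by (induction us) (auto simp: zero_fun_def)
  then have "deriv_form (0 :: 'a \<Rightarrow> real) i x us = 0" for i x us
    by (simp add: deriv_form_def)
  then have "mult_norm i (deriv_form (0 :: 'a \<Rightarrow> real) i x) \<le> 0" for i x
    by (intro mult_norm_leI) auto
  then have "(SUP x\<in>B. mult_norm i (deriv_form (0 :: 'a \<Rightarrow> real) i x)) \<le> 0" for i
    by (intro cSUP_least B_nonempty)
  then have "N 0 \<le> 0"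
    unfolding Cbk_norm_def using B_nonempty by (auto simp: sum_nonpos)
  then show ?thesis using norm_nonneg[OF Cbk_zero[OF open_B]] by simp
qed

lemma integral_mult_abs_le:
  assumes w: "bcont w" "\<And>x. x \<in> B \<Longrightarrow> \<bar>w x\<bar> \<le> c" and u: "u \<in> G"
  shows "\<bar>\<integral>x. w x * u x \<partial>\<mu>\<bar> \<le> c * N u"
proof (rule integral_abs_le)
  show "bcont (\<lambda>x. w x * u x)" by (intro bcont_mult w G_bcont u)
  fix x assume x: "x \<in> B"
  then have "0 \<le> c" using w(2)[OF x] by linarith
  then show "\<bar>w x * u x\<bar> \<le> c * N u"
    unfolding abs_mult using x by (intro mult_mono w abs_le_norm u) auto
qed

text \<open>
  The value \<open>0\<close> off \<open>G\<close> is the normalisation required of members of \<^const>\<open>Cbk_dual\<close>.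
\<close>

definition integral_against :: "('a \<Rightarrow> real) \<Rightarrow> ('a \<Rightarrow> real) \<Rightarrow> real" where
  "integral_against w u = (if u \<in> G then \<integral>x. w x * u x \<partial>\<mu> else 0)"

lemma integral_against_bounded_linear:
  assumes w: "bcont w"
  shows "bounded_linear_between G N UNIV abs (integral_against w)"
  unfolding bounded_linear_between_def
proof (intro conjI ballI allI)
  have int: "integrable \<mu> (\<lambda>x. w x * u x)" if "u \<in> G" for u
    by (intro bcont_integrable bcont_mult w G_bcont that)
  show "integral_against w (u + v) = integral_against w u + integral_against w v" if "u \<in> G" "v \<in> G" for u v
    using that Cbk_add[OF open_B that] int[OF that(1)] int[OF that(2)]
    by (simp add: integral_against_def distrib_left)
  show "integral_against w (c *\<^sub>R u) = c *\<^sub>R integral_against w u" if "u \<in> G" for c u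
    using that Cbk_scaleR[OF open_B that, of c] by (simp add: integral_against_def mult.left_commute)
  obtain R where "\<And>x. x \<in> B \<Longrightarrow> \<bar>w x\<bar> \<le> R" using bcontD[OF w] by blast
  then have "\<forall>u\<in>G. \<bar>integral_against w u\<bar> \<le> R * N u"
    using integral_mult_abs_le[OF w] by (simp add: integral_against_def)
  then show "\<exists>C. \<forall>u\<in>G. \<bar>integral_against w u\<bar> \<le> C * N u" by blast
qed simp

lemma integral_against_in_dual: "bcont w \<Longrightarrow> integral_against w \<in> Cbk_dual k B"
  unfolding Cbk_dual_def using integral_against_bounded_linear by (simp add: integral_against_def)

lemma dual_norm_integral_against_le:
  assumes w: "bcont w" "\<And>x. x \<in> B \<Longrightarrow> \<bar>w x\<bar> \<le> c"
  shows "Cbk_dual_norm k B (integral_against w) \<le> c"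
  unfolding Cbk_dual_norm_def
proof (rule cSUP_least)
  show "{u \<in> G. N u \<le> 1} \<noteq> {}" using Cbk_zero[OF open_B] norm_zero by force
  fix u assume u: "u \<in> {u \<in> G. N u \<le> 1}"
  obtain x where "x \<in> B" using B_nonempty by blast
  then have "0 \<le> c" using w(2)[of x] by linarith
  have "\<bar>integral_against w u\<bar> \<le> c * N u" using integral_mult_abs_le[OF w] u by (simp add: integral_against_def)
  also have "\<dots> \<le> c * 1" using u \<open>0 \<le> c\<close> by (intro mult_left_mono) auto
  finally show "\<bar>integral_against w u\<bar> \<le> c" by simp
qed

section \<open>Derivatives of the divergence\<close>

lemma phi_minus_eq: "P \<in> M \<Longrightarrow> \<phi> (-\<alpha>) P x = emb (-\<alpha>) (emb_inv \<alpha> (\<phi> \<alpha> P x))"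
  by (simp only: phi_eq[of P "-\<alpha>" x] phi_1_eq[of P x \<alpha>, symmetric])

text \<open>
  The transition \<open>\<phi> \<alpha> P \<mapsto> \<phi> (-\<alpha>) P\<close> between dual coordinates is differentiable, pointwise on \<open>B\<close> and
  uniformly, with respect to the norm of \<open>G\<close>. Bounds \<open>-R\<close> and \<open>R\<close> for the log density are relaxed
  by \<open>1\<close>; by monotonicity of \<^const>\<open>emb\<close> this leaves a margin \<open>\<eta>\<close> for the perturbation \<open>h\<close>, inside
  a compact interval of the range of the coordinate.
\<close>

lemma phi_transition_differentiable:
  assumes P: "P \<in> M" and "\<epsilon> > 0"
  obtains \<delta> where "\<delta> > 0"
    and "\<And>h. h \<in> G \<Longrightarrow> N h < \<delta> \<Longrightarrow> \<phi> \<alpha> P + h \<in> \<phi> \<alpha> ` M"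
    and "\<And>P' h x. P' \<in> M \<Longrightarrow> h \<in> G \<Longrightarrow> N h < \<delta> \<Longrightarrow> \<phi> \<alpha> P' = \<phi> \<alpha> P + h \<Longrightarrow> x \<in> B \<Longrightarrow>
      \<bar>\<phi> (-\<alpha>) P' x - \<phi> (-\<alpha>) P x - exp (\<alpha> * \<phi> 1 P x) * h x\<bar> \<le> \<epsilon> * N h"
proof -
  obtain R where R: "R > 0" "\<And>x. x \<in> B \<Longrightarrow> \<bar>\<phi> 1 P x\<bar> \<le> R"
    using bcontD[OF phi_bcont[OF P]] by blast
  define l r where "l = emb \<alpha> (- (R + 1))" and "r = emb \<alpha> (R + 1)"
  define \<eta> where "\<eta> = min (emb \<alpha> (- R) - l) (r - emb \<alpha> R)"
  have "\<eta> > 0"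
    using strict_monoD[OF emb_strict_mono, of "- (R + 1)" "- R" \<alpha>] strict_monoD[OF emb_strict_mono, of R "R + 1" \<alpha>]
    by (simp add: \<eta>_def l_def r_def)
  \<comment> \<open>An affine function on an interval is least at an end point.\<close>
  define m where "m = min (1 + (1 - \<alpha>) / 2 * l) (1 + (1 - \<alpha>) / 2 * r)"
  have "m > 0" unfolding m_def l_def r_def one_plus_emb by simp
  have m: "m \<le> 1 + (1 - \<alpha>) / 2 * y" if "y \<in> {l..r}" for y
  proof (cases "0 \<le> (1 - \<alpha>) / 2")
    case True
    then have "(1 - \<alpha>) / 2 * l \<le> (1 - \<alpha>) / 2 * y" using that by (intro mult_left_mono) auto
    then show ?thesis by (simp add: m_def)
  next
    case False
    then have "(1 - \<alpha>) / 2 * r \<le> (1 - \<alpha>) / 2 * y" using that by (intro mult_left_mono_neg) auto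
    then show ?thesis by (simp add: m_def)
  qed
  have range: "\<phi> \<alpha> P x + t \<in> {l..r}" if "x \<in> B" "\<bar>t\<bar> < \<eta>" for x t
  proof -
    have "- R \<le> \<phi> 1 P x" "\<phi> 1 P x \<le> R" using R(2)[OF that(1)] by auto
    then have "emb \<alpha> (- R) \<le> \<phi> \<alpha> P x" "\<phi> \<alpha> P x \<le> emb \<alpha> R"
      unfolding phi_eq[OF P, of \<alpha>] by (simp_all add: strict_mono_less_eq[OF emb_strict_mono])
    then show ?thesis using that(2) by (auto simp: \<eta>_def)
  qed
  obtain \<delta> where \<delta>: "\<delta> > 0" "\<And>y h. y \<in> {l..r} \<Longrightarrow> \<bar>h\<bar> < \<delta> \<Longrightarrow> y + h \<in> {l..r} \<Longrightarrow>
    \<bar>emb (-\<alpha>) (emb_inv \<alpha> (y + h)) - emb (-\<alpha>) (emb_inv \<alpha> y) - exp (\<alpha> * emb_inv \<alpha> y) * h\<bar> \<le> \<epsilon> * \<bar>h\<bar>"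
    by (rule emb_minus_emb_inv_uniformly_differentiable[of l r \<alpha> \<epsilon>])
      (use m \<open>m > 0\<close> \<open>\<epsilon> > 0\<close> in force)+
  show ?thesis
  proof (rule that[of "min \<delta> \<eta>"])
    show "min \<delta> \<eta> > 0" using \<delta>(1) \<open>\<eta> > 0\<close> by simp
  next
    fix h assume h: "h \<in> G" "N h < min \<delta> \<eta>"
    have "m \<le> 1 + (1 - \<alpha>) / 2 * (\<phi> \<alpha> P + h) x" if "x \<in> B" for x
    proof -
      have "\<phi> \<alpha> P x + h x \<in> {l..r}"
        using abs_le_norm[OF h(1) that] h(2) by (intro range that) auto
      from m[OF this] show ?thesis by simp
    qed
    then show "\<phi> \<alpha> P + h \<in> \<phi> \<alpha> ` M"
      unfolding phi_image_iff using \<open>m > 0\<close> Cbk_add[OF open_B phi_in_G[OF P] h(1)] by blast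
  next
    fix P' h x
    assume P': "P' \<in> M" and h: "h \<in> G" "N h < min \<delta> \<eta>" and eq: "\<phi> \<alpha> P' = \<phi> \<alpha> P + h" and x: "x \<in> B"
    note hx = abs_le_norm[OF h(1) x]
    have "\<bar>emb (-\<alpha>) (emb_inv \<alpha> (\<phi> \<alpha> P x + h x)) - emb (-\<alpha>) (emb_inv \<alpha> (\<phi> \<alpha> P x))
        - exp (\<alpha> * emb_inv \<alpha> (\<phi> \<alpha> P x)) * h x\<bar> \<le> \<epsilon> * \<bar>h x\<bar>"
      using range[OF x, of 0] range[OF x, of "h x"] hx h(2) \<open>\<eta> > 0\<close> by (intro \<delta>(2)) auto
    also have "\<dots> \<le> \<epsilon> * N h" using hx \<open>\<epsilon> > 0\<close> by simp
    finally show "\<bar>\<phi> (-\<alpha>) P' x - \<phi> (-\<alpha>) P x - exp (\<alpha> * \<phi> 1 P x) * h x\<bar> \<le> \<epsilon> * N h"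
      unfolding phi_minus_eq[OF P'] phi_minus_eq[OF P] eq phi_1_eq[OF P, where \<alpha> = \<alpha>] by simp
  qed
qed

definition grad :: "real \<Rightarrow> 'a measure \<Rightarrow> ('a \<Rightarrow> real) \<Rightarrow> ('a \<Rightarrow> real) \<Rightarrow> real" where
  "grad \<alpha> Q a = integral_against (\<lambda>x. \<phi> (-\<alpha>) (\<phi>inv \<alpha> a) x - \<phi> (-\<alpha>) Q x)"

definition hess :: "real \<Rightarrow> ('a \<Rightarrow> real) \<Rightarrow> ('a \<Rightarrow> real) \<Rightarrow> ('a \<Rightarrow> real) \<Rightarrow> real" where
  "hess \<alpha> a u = integral_against (\<lambda>x. exp (\<alpha> * \<phi> 1 (\<phi>inv \<alpha> a) x) * u x)"

lemma phi_image_subset: "\<phi> \<alpha> ` M \<subseteq> G"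
  using phi_in_G by blast

text \<open>
  The three-point identity says that the remainder of first order is itself a divergence. It is at
  most the symmetrised divergence of \<open>P'\<close> and \<open>P\<close>, which is the pairing of the increments of the dual
  coordinates.
\<close>

lemma divergence_remainder:
  assumes P: "P \<in> M" and P': "P' \<in> M" and Q: "Q \<in> M" and h: "h \<in> G" and eq: "\<phi> \<alpha> P' = \<phi> \<alpha> P + h"
  shows "D \<alpha> P' Q - D \<alpha> P Q - integral_against (\<lambda>x. \<phi> (-\<alpha>) P x - \<phi> (-\<alpha>) Q x) h = D \<alpha> P' P"
    and "D \<alpha> P' P \<le> integral_against (\<lambda>x. \<phi> (-\<alpha>) P' x - \<phi> (-\<alpha>) P x) h"
proof -
  have ip: "ip \<mu> (\<phi> \<alpha> P' - \<phi> \<alpha> P) (\<phi> (-\<alpha>) R - \<phi> (-\<alpha>) P) = integral_against (\<lambda>x. \<phi> (-\<alpha>) R x - \<phi> (-\<alpha>) P x) h" for R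
    using h by (simp add: ip_def integral_against_def eq mult.commute)
  have neg: "integral_against (\<lambda>x. \<phi> (-\<alpha>) P x - \<phi> (-\<alpha>) Q x) h = - integral_against (\<lambda>x. \<phi> (-\<alpha>) Q x - \<phi> (-\<alpha>) P x) h"
    using h by (simp add: integral_against_def left_diff_distrib flip: Bochner_Integration.integral_minus)
  show "D \<alpha> P' Q - D \<alpha> P Q - integral_against (\<lambda>x. \<phi> (-\<alpha>) P x - \<phi> (-\<alpha>) Q x) h = D \<alpha> P' P"
    using divergence_three_point[OF P' P Q, of \<alpha>] unfolding ip neg by simp
  have "D \<alpha> P' P' = 0" using divergence_eq_0_iff[OF P' P'] by simp
  then show "D \<alpha> P' P \<le> integral_against (\<lambda>x. \<phi> (-\<alpha>) P' x - \<phi> (-\<alpha>) P x) h"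
    using divergence_three_point[OF P' P P', of \<alpha>] divergence_nonneg[OF P P', of \<alpha>] unfolding ip by linarith
qed

lemma phi_image_interior:
  assumes a: "a \<in> \<phi> \<alpha> ` M"
  shows "\<exists>\<delta>>0. \<forall>h\<in>G. N h < \<delta> \<longrightarrow> a + h \<in> \<phi> \<alpha> ` M"
proof -
  obtain P where P: "P \<in> M" "a = \<phi> \<alpha> P" using a by blast
  show ?thesis
    by (rule phi_transition_differentiable[OF P(1) zero_less_one, of \<alpha>]) (use P(2) in blast)
qed

text \<open>
  By \<open>divergence_remainder\<close> the remainder is at most the norm of \<open>h\<close> times the supremum of the increment
  of \<open>\<phi> (-\<alpha>)\<close>, which is Lipschitz in \<open>h\<close>. The remainder is therefore quadratic.
\<close>

lemma divergence_has_frechet_derivative: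
  assumes Q: "Q \<in> M" and a: "a \<in> \<phi> \<alpha> ` M"
  shows "has_frechet_derivative_at G N UNIV abs (\<phi> \<alpha> ` M) (\<lambda>b. D \<alpha> (\<phi>inv \<alpha> b) Q) (grad \<alpha> Q a) a"
  unfolding has_frechet_derivative_at_def
proof (intro conjI allI impI)
  obtain P where P: "P \<in> M" and aP: "a = \<phi> \<alpha> P" using a by blast
  have grad: "grad \<alpha> Q a = integral_against (\<lambda>x. \<phi> (-\<alpha>) P x - \<phi> (-\<alpha>) Q x)"
    by (simp add: grad_def aP P)
  show "bounded_linear_between G N UNIV abs (grad \<alpha> Q a)"
    unfolding grad by (intro integral_against_bounded_linear bcont_diff phi_bcont P Q)
  fix \<epsilon> :: real assume "\<epsilon> > 0"
  obtain C where C: "C > 0" "\<And>x. x \<in> B \<Longrightarrow> \<bar>exp (\<alpha> * \<phi> 1 P x)\<bar> \<le> C"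
    using bcontD[OF bcont_exp[OF bcont_mult[OF bcont_const phi_bcont[OF P]]]] by blast
  obtain \<delta> where \<delta>: "\<delta> > 0"
    "\<And>P' h x. P' \<in> M \<Longrightarrow> h \<in> G \<Longrightarrow> N h < \<delta> \<Longrightarrow> \<phi> \<alpha> P' = \<phi> \<alpha> P + h \<Longrightarrow> x \<in> B \<Longrightarrow>
      \<bar>\<phi> (-\<alpha>) P' x - \<phi> (-\<alpha>) P x - exp (\<alpha> * \<phi> 1 P x) * h x\<bar> \<le> 1 * N h"
    by (rule phi_transition_differentiable[OF P zero_less_one, of \<alpha>]) (rule that)
  show "\<exists>\<delta>>0. \<forall>h\<in>G. N h < \<delta> \<longrightarrow> a + h \<in> \<phi> \<alpha> ` M \<longrightarrow>
      \<bar>D \<alpha> (\<phi>inv \<alpha> (a + h)) Q - D \<alpha> (\<phi>inv \<alpha> a) Q - grad \<alpha> Q a h\<bar> \<le> \<epsilon> * N h"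
  proof (intro exI[of _ "min \<delta> (\<epsilon> / (C + 1))"] conjI ballI impI)
    show "0 < min \<delta> (\<epsilon> / (C + 1))" using \<delta>(1) \<open>\<epsilon> > 0\<close> C(1) by simp
    fix h assume h: "h \<in> G" "N h < min \<delta> (\<epsilon> / (C + 1))" and ah: "a + h \<in> \<phi> \<alpha> ` M"
    obtain P' where P': "P' \<in> M" "a + h = \<phi> \<alpha> P'" using ah by blast
    then have eq: "\<phi> \<alpha> P' = \<phi> \<alpha> P + h" by (simp add: aP)
    have "\<bar>\<phi> (-\<alpha>) P' x - \<phi> (-\<alpha>) P x\<bar> \<le> (C + 1) * N h" if x: "x \<in> B" for x
    proof -
      have "\<bar>exp (\<alpha> * \<phi> 1 P x) * h x\<bar> \<le> C * N h"
        unfolding abs_mult using C(1) by (intro mult_mono C(2) abs_le_norm h x) auto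
      then show ?thesis using \<delta>(2)[OF P'(1) h(1) _ eq x] h(2) by (simp add: distrib_right)
    qed
    then have "\<bar>integral_against (\<lambda>x. \<phi> (-\<alpha>) P' x - \<phi> (-\<alpha>) P x) h\<bar> \<le> (C + 1) * N h * N h"
      unfolding integral_against_def using h(1) P'(1) P
      by (simp only: if_True) (intro integral_mult_abs_le bcont_diff phi_bcont; simp)
    also have "\<dots> \<le> \<epsilon> * N h"
      using h(2) C(1) norm_nonneg[OF h(1)] by (intro mult_right_mono) (auto simp: field_simps)
    finally have "D \<alpha> P' P \<le> \<epsilon> * N h"
      using divergence_remainder(2)[OF P P'(1) Q h(1) eq] by linarith
    then show "\<bar>D \<alpha> (\<phi>inv \<alpha> (a + h)) Q - D \<alpha> (\<phi>inv \<alpha> a) Q - grad \<alpha> Q a h\<bar> \<le> \<epsilon> * N h"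
      using divergence_remainder(1)[OF P P'(1) Q h(1) eq] divergence_nonneg[OF P'(1) P, of \<alpha>]
      unfolding grad by (simp add: P' aP P eq[symmetric])
  qed
qed (use a phi_image_subset phi_image_interior[OF a] in auto)

text \<open>
  The gradient is \<open>\<phi> (-\<alpha>)\<close> up to a constant, acting by integration, so its derivative is that of the
  transition between dual coordinates.
\<close>

lemma grad_has_frechet_derivative:
  assumes Q: "Q \<in> M" and a: "a \<in> \<phi> \<alpha> ` M"
  shows "has_frechet_derivative_at G N (Cbk_dual k B) (Cbk_dual_norm k B) (\<phi> \<alpha> ` M)
    (grad \<alpha> Q) (hess \<alpha> a) a"
  unfolding has_frechet_derivative_at_def
proof (intro conjI allI impI ballI)
  obtain P where P: "P \<in> M" and aP: "a = \<phi> \<alpha> P" using a by blast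
  define e where "e x = exp (\<alpha> * \<phi> 1 P x)" for x
  have e: "bcont e"
    unfolding e_def by (intro bcont_exp bcont_mult bcont_const phi_bcont P)
  have eG: "bcont (\<lambda>x. e x * u x)" if "u \<in> G" for u by (intro bcont_mult e G_bcont that)
  have hess: "hess \<alpha> a u = integral_against (\<lambda>x. e x * u x)" for u
    by (simp add: hess_def aP P e_def)
  show "bounded_linear_between G N (Cbk_dual k B) (Cbk_dual_norm k B) (hess \<alpha> a)"
    unfolding bounded_linear_between_def
  proof (intro conjI ballI allI)
    show "hess \<alpha> a u \<in> Cbk_dual k B" if "u \<in> G" for u
      using that by (simp add: hess integral_against_in_dual eG)
    have int: "integrable \<mu> (\<lambda>x. e x * u x * v x)" if "u \<in> G" "v \<in> G" for u v
      by (intro bcont_integrable bcont_mult e G_bcont that)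
    show "hess \<alpha> a (u + v) = hess \<alpha> a u + hess \<alpha> a v"
      if "u \<in> G" "v \<in> G" for u v
      using that Cbk_add[OF open_B that] int[OF that(1)] int[OF that(2)]
      by (simp add: hess integral_against_def fun_eq_iff algebra_simps)
    show "hess \<alpha> a (c *\<^sub>R u) = c *\<^sub>R hess \<alpha> a u" if "u \<in> G" for c u
      using that Cbk_scaleR[OF open_B that, of c] by (simp add: hess integral_against_def fun_eq_iff mult.assoc mult.left_commute)
    obtain C where C: "C > 0" "\<And>x. x \<in> B \<Longrightarrow> \<bar>e x\<bar> \<le> C" using bcontD[OF e] by blast
    have "Cbk_dual_norm k B (hess \<alpha> a u) \<le> C * N u" if u: "u \<in> G" for u
      unfolding hess
    proof (rule dual_norm_integral_against_le[OF eG[OF u]])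
      show "\<bar>e x * u x\<bar> \<le> C * N u" if "x \<in> B" for x
        unfolding abs_mult using C(1) by (intro mult_mono C(2) abs_le_norm u that) auto
    qed
    then show "\<exists>C. \<forall>u\<in>G. Cbk_dual_norm k B (hess \<alpha> a u) \<le> C * N u" by auto
  qed
  show "grad \<alpha> Q b \<in> Cbk_dual k B" if b: "b \<in> \<phi> \<alpha> ` M" for b
    unfolding grad_def using b Q by (intro integral_against_in_dual bcont_diff phi_bcont) auto
  fix \<epsilon> :: real assume "\<epsilon> > 0"
  obtain \<delta> where \<delta>: "\<delta> > 0"
    "\<And>P' h x. P' \<in> M \<Longrightarrow> h \<in> G \<Longrightarrow> N h < \<delta> \<Longrightarrow> \<phi> \<alpha> P' = \<phi> \<alpha> P + h \<Longrightarrow> x \<in> B \<Longrightarrow>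
      \<bar>\<phi> (-\<alpha>) P' x - \<phi> (-\<alpha>) P x - exp (\<alpha> * \<phi> 1 P x) * h x\<bar> \<le> \<epsilon> * N h"
    by (rule phi_transition_differentiable[OF P \<open>\<epsilon> > 0\<close>, of \<alpha>]) (rule that)
  show "\<exists>\<delta>>0. \<forall>h\<in>G. N h < \<delta> \<longrightarrow> a + h \<in> \<phi> \<alpha> ` M \<longrightarrow>
      Cbk_dual_norm k B (grad \<alpha> Q (a + h) - grad \<alpha> Q a - hess \<alpha> a h) \<le> \<epsilon> * N h"
  proof (intro exI[of _ \<delta>] conjI ballI impI \<delta>(1))
    fix h assume h: "h \<in> G" "N h < \<delta>" and ah: "a + h \<in> \<phi> \<alpha> ` M"
    obtain P' where P': "P' \<in> M" "a + h = \<phi> \<alpha> P'" using ah by blast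
    then have eq: "\<phi> \<alpha> P' = \<phi> \<alpha> P + h" by (simp add: aP)
    \<comment> \<open>The remainder is integration against the remainder of the transition map.\<close>
    define w where "w x = \<phi> (-\<alpha>) P' x - \<phi> (-\<alpha>) P x - e x * h x" for x
    have w: "bcont w" unfolding w_def by (intro bcont_diff phi_bcont P P' eG h)
    have int: "integrable \<mu> (\<lambda>x. \<phi> (-\<alpha>) R x * v x)" "integrable \<mu> (\<lambda>x. e x * h x * v x)"
      if "R \<in> M" "v \<in> G" for R v
      by (intro bcont_integrable bcont_mult phi_bcont e G_bcont that h)+
    have "grad \<alpha> Q (a + h) - grad \<alpha> Q a - hess \<alpha> a h = integral_against w"
    proof
      show "(grad \<alpha> Q (a + h) - grad \<alpha> Q a - hess \<alpha> a h) v = integral_against w v" for v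
        using int[OF P'(1), of v] int[OF P, of v] int[OF Q, of v]
        by (simp add: grad_def hess[unfolded aP] integral_against_def P' P aP eq[symmetric] w_def left_diff_distrib)
    qed
    moreover have "\<bar>w x\<bar> \<le> \<epsilon> * N h" if "x \<in> B" for x
      unfolding w_def e_def by (rule \<delta>(2)[OF P'(1) h eq that])
    ultimately show "Cbk_dual_norm k B (grad \<alpha> Q (a + h) - grad \<alpha> Q a - hess \<alpha> a h) \<le> \<epsilon> * N h"
      using dual_norm_integral_against_le[OF w] h(1) by simp
  qed
qed (use a phi_image_subset phi_image_interior[OF a] in auto)

section \<open>Strict convexity and Legendre duality\<close>

text \<open>
  Let \<open>S\<close> have the coordinate \<open>(1 - t) *\<^sub>R a + t *\<^sub>R b\<close>. In the three-point identities through \<open>S\<close> the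
  inner products cancel in the convex combination, and the convexity gap is
  \<open>(1 - t) * D \<alpha> P S + t * D \<alpha> P' S\<close>.
\<close>

lemma divergence_strictly_convex:
  assumes Q: "Q \<in> M"
  shows "strictly_convex_on (\<phi> \<alpha> ` M) (\<lambda>b. D \<alpha> (\<phi>inv \<alpha> b) Q)"
  unfolding strictly_convex_on_def
proof (intro conjI convex_phi_image ballI allI impI)
  fix a b and t :: real
  assume a: "a \<in> \<phi> \<alpha> ` M" and b: "b \<in> \<phi> \<alpha> ` M" and "a \<noteq> b" and t: "0 < t" "t < 1"
  obtain P P' where P: "P \<in> M" "a = \<phi> \<alpha> P" and P': "P' \<in> M" "b = \<phi> \<alpha> P'" using a b by blast
  have "(1 - t) *\<^sub>R a + t *\<^sub>R b \<in> \<phi> \<alpha> ` M"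
    using t by (intro convexD[OF convex_phi_image a b]) auto
  then obtain S where S: "S \<in> M" "(1 - t) *\<^sub>R a + t *\<^sub>R b = \<phi> \<alpha> S" by blast
  have Sx: "\<phi> \<alpha> S x = (1 - t) * a x + t * b x" for x
    unfolding S(2)[symmetric] by simp
  have ne: "P \<noteq> S"
  proof
    assume "P = S"
    then have "t * (a x - b x) = 0" for x using Sx[of x] P(2) by (simp add: algebra_simps)
    then show False using t \<open>a \<noteq> b\<close> by auto
  qed
  define w where "w x = \<phi> (-\<alpha>) Q x - \<phi> (-\<alpha>) S x" for x
  have w: "bcont w" unfolding w_def by (intro bcont_diff phi_bcont Q S)
  have int: "integrable \<mu> (\<lambda>x. (\<phi> \<alpha> R x - \<phi> \<alpha> S x) * w x)" if "R \<in> M" for R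
    by (intro bcont_integrable bcont_mult bcont_diff phi_bcont that S w)
  have "(1 - t) * ip \<mu> (\<phi> \<alpha> P - \<phi> \<alpha> S) (\<phi> (-\<alpha>) Q - \<phi> (-\<alpha>) S) + t * ip \<mu> (\<phi> \<alpha> P' - \<phi> \<alpha> S) (\<phi> (-\<alpha>) Q - \<phi> (-\<alpha>) S)
      = (\<integral>x. (1 - t) * ((\<phi> \<alpha> P x - \<phi> \<alpha> S x) * w x) + t * ((\<phi> \<alpha> P' x - \<phi> \<alpha> S x) * w x) \<partial>\<mu>)"
    using int[OF P(1)] int[OF P'(1)] by (simp add: ip_def w_def)
  also have "\<dots> = (\<integral>x. 0 \<partial>\<mu>)"
    by (intro Bochner_Integration.integral_cong) (simp_all add: Sx P(2) P'(2) algebra_simps)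
  finally have ip: "(1 - t) * ip \<mu> (\<phi> \<alpha> P - \<phi> \<alpha> S) (\<phi> (-\<alpha>) Q - \<phi> (-\<alpha>) S) + t * ip \<mu> (\<phi> \<alpha> P' - \<phi> \<alpha> S) (\<phi> (-\<alpha>) Q - \<phi> (-\<alpha>) S) = 0"
    by simp
  have "(1 - t) * D \<alpha> P Q + t * D \<alpha> P' Q = D \<alpha> S Q + (1 - t) * D \<alpha> P S + t * D \<alpha> P' S"
    using ip divergence_three_point[OF P(1) S(1) Q, of \<alpha>] divergence_three_point[OF P'(1) S(1) Q, of \<alpha>]
    by algebra
  moreover have "0 < (1 - t) * D \<alpha> P S" using t divergence_pos[OF P(1) S(1) ne] by simp
  moreover have "0 \<le> t * D \<alpha> P' S" using t divergence_nonneg[OF P'(1) S(1)] by simp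
  ultimately show "D \<alpha> (\<phi>inv \<alpha> ((1 - t) *\<^sub>R a + t *\<^sub>R b)) Q
      < (1 - t) * D \<alpha> (\<phi>inv \<alpha> a) Q + t * D \<alpha> (\<phi>inv \<alpha> b) Q"
    unfolding S(2) unfolding P(2) P'(2) using P(1) P'(1) S(1) by simp
qed

text \<open>
  The objective at \<open>\<phi> \<alpha> R\<close> falls short of the claimed maximum by exactly \<open>D \<alpha> R P\<close>, which makes
  \<open>R = P\<close> the unique maximiser.
\<close>

lemma legendre_gap:
  assumes P: "P \<in> M" and Q: "Q \<in> M" and R: "R \<in> M"
  shows "ip \<mu> (\<phi> (-\<alpha>) P - \<phi> (-\<alpha>) Q) (\<phi> \<alpha> R - \<phi> \<alpha> Q) - D \<alpha> R Q = D (-\<alpha>) P Q - D \<alpha> R P"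
  using divergence_three_point[OF R Q P, of \<alpha>] divergence_minus[OF P Q, of \<alpha>]
  by (simp add: ip_def mult.commute)

lemma legendre_maximum:
  fixes \<alpha> :: real
  assumes P: "P \<in> M" and Q: "Q \<in> M"
  defines "J \<equiv> \<lambda>b. ip \<mu> (\<phi> (-\<alpha>) P - \<phi> (-\<alpha>) Q) (b - \<phi> \<alpha> Q) - D \<alpha> (\<phi>inv \<alpha> b) Q"
  shows "D (-\<alpha>) P Q = J (\<phi> \<alpha> P)"
    and "is_arg_max J (\<lambda>b. b \<in> \<phi> \<alpha> ` M) b \<longleftrightarrow> b = \<phi> \<alpha> P"
proof -
  have J: "J (\<phi> \<alpha> R) = D (-\<alpha>) P Q - D \<alpha> R P" if "R \<in> M" for R
    using legendre_gap[OF P Q that] that by (simp add: J_def)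
  have zero: "D \<alpha> P P = 0" using divergence_eq_0_iff[OF P P] by simp
  show max: "D (-\<alpha>) P Q = J (\<phi> \<alpha> P)" by (simp add: J[OF P] zero)
  show "is_arg_max J (\<lambda>b. b \<in> \<phi> \<alpha> ` M) b \<longleftrightarrow> b = \<phi> \<alpha> P"
  proof
    assume b: "is_arg_max J (\<lambda>b. b \<in> \<phi> \<alpha> ` M) b"
    then obtain R where R: "R \<in> M" "b = \<phi> \<alpha> R" unfolding is_arg_max_def by blast
    have "\<not> J b < J (\<phi> \<alpha> P)" using b P unfolding is_arg_max_def by blast
    then have "R = P"
      using divergence_pos[OF R(1) P, of \<alpha>] by (auto simp: R J P zero)
    then show "b = \<phi> \<alpha> P" by (simp add: R)
  next
    assume b: "b = \<phi> \<alpha> P"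
    have "\<not> J b < J (\<phi> \<alpha> R)" if "R \<in> M" for R
      using divergence_nonneg[OF that P, of \<alpha>] by (simp add: b J P that zero)
    then show "is_arg_max J (\<lambda>b. b \<in> \<phi> \<alpha> ` M) b" unfolding is_arg_max_def using b P by blast
  qed
qed

end

theorem proposition3p1:
  fixes B :: "'a::banach set" and \<mu> :: "'a measure" and k :: nat and \<alpha> :: real
  assumes "open B"
    and "prob_space \<mu>"
    and "sets \<mu> = sets (restrict_space borel B)"
    and "\<And>A. A \<in> sets \<mu> \<Longrightarrow> open A \<Longrightarrow> A \<noteq> {} \<Longrightarrow> measure \<mu> A > 0"
  defines "G \<equiv> Cbk k B" and "M \<equiv> M_set k B \<mu>"
    and "\<phi> \<equiv> phi k B \<mu>" and "\<phi>inv \<equiv> phi_inv k B \<mu>"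
    and "\<D> \<equiv> divergence k B \<mu>"
  shows
    "(\<forall>P\<in>M. \<forall>Q\<in>M. \<D> (-\<alpha>) P Q = \<D> \<alpha> Q P \<and> \<D> \<alpha> Q P \<ge> 0 \<and> (\<D> \<alpha> Q P = 0 \<longleftrightarrow> P = Q)) \<and>
     (\<forall>P\<in>M. \<forall>Q\<in>M. \<forall>R\<in>M.
        \<D> \<alpha> P R = \<D> \<alpha> P Q + \<D> \<alpha> Q R - ip \<mu> (\<phi> \<alpha> P - \<phi> \<alpha> Q) (\<phi> (-\<alpha>) R - \<phi> (-\<alpha>) Q)) \<and>
     convex (\<phi> \<alpha> ` M) \<and>
     (\<forall>Q\<in>M.
        (\<exists>F1 F2. \<forall>a\<in>\<phi> \<alpha> ` M.
           has_frechet_derivative_at G (Cbk_norm k B) UNIV abs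
             (\<phi> \<alpha> ` M) (\<lambda>b. \<D> \<alpha> (\<phi>inv \<alpha> b) Q) (F1 a) a \<and>
           has_frechet_derivative_at G (Cbk_norm k B) (Cbk_dual k B) (Cbk_dual_norm k B)
             (\<phi> \<alpha> ` M) F1 (F2 a) a \<and>
           (\<forall>u\<in>G. F1 a u = ip \<mu> (\<phi> (-\<alpha>) (\<phi>inv \<alpha> a) - \<phi> (-\<alpha>) Q) u) \<and>
           (\<forall>u\<in>G. \<forall>v\<in>G. F2 a u v =
              integral\<^sup>L \<mu> (exp_G (\<alpha> *\<^sub>R \<phi> 1 (\<phi>inv \<alpha> a)) * u * v))) \<and>
        strictly_convex_on (\<phi> \<alpha> ` M) (\<lambda>b. \<D> \<alpha> (\<phi>inv \<alpha> b) Q)) \<and>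
     (\<forall>Q\<in>M. \<forall>a\<in>\<phi> (-\<alpha>) ` M.
        (let J = (\<lambda>b. ip \<mu> (a - \<phi> (-\<alpha>) Q) (b - \<phi> \<alpha> Q) - \<D> \<alpha> (\<phi>inv \<alpha> b) Q);
             b0 = \<phi> \<alpha> (\<phi>inv (-\<alpha>) a)
         in \<D> (-\<alpha>) (\<phi>inv (-\<alpha>) a) Q = J b0 \<and>
            (\<forall>b. is_arg_max J (\<lambda>b. b \<in> \<phi> \<alpha> ` M) b \<longleftrightarrow> b = b0)))"
proof -
  interpret reference_measure \<mu> B k
    using assms(1-4) by (intro reference_measure.intro reference_measure_axioms.intro)
  show ?thesis
    unfolding G_def M_def \<phi>_def \<phi>inv_def \<D>_def
  proof (intro conjI ballI)
    fix P Q assume P: "P \<in> M_set k B \<mu>" and Q: "Q \<in> M_set k B \<mu>"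
    show "divergence k B \<mu> (-\<alpha>) P Q = divergence k B \<mu> \<alpha> Q P"
      by (rule divergence_minus[OF P Q])
    show "0 \<le> divergence k B \<mu> \<alpha> Q P" by (rule divergence_nonneg[OF Q P])
    show "divergence k B \<mu> \<alpha> Q P = 0 \<longleftrightarrow> P = Q" using divergence_eq_0_iff[OF Q P] by blast
  next
    fix P Q R assume "P \<in> M_set k B \<mu>" "Q \<in> M_set k B \<mu>" "R \<in> M_set k B \<mu>"
    then show "divergence k B \<mu> \<alpha> P R = divergence k B \<mu> \<alpha> P Q + divergence k B \<mu> \<alpha> Q R
        - ip \<mu> (phi k B \<mu> \<alpha> P - phi k B \<mu> \<alpha> Q) (phi k B \<mu> (-\<alpha>) R - phi k B \<mu> (-\<alpha>) Q)"
      by (rule divergence_three_point)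
  next
    show "convex (phi k B \<mu> \<alpha> ` M_set k B \<mu>)" by (rule convex_phi_image)
  next
    fix Q assume Q: "Q \<in> M_set k B \<mu>"
    show "strictly_convex_on (phi k B \<mu> \<alpha> ` M_set k B \<mu>) (\<lambda>b. divergence k B \<mu> \<alpha> (phi_inv k B \<mu> \<alpha> b) Q)"
      by (rule divergence_strictly_convex[OF Q])
    show "\<exists>F1 F2. \<forall>a\<in>phi k B \<mu> \<alpha> ` M_set k B \<mu>.
           has_frechet_derivative_at (Cbk k B) (Cbk_norm k B) UNIV abs
             (phi k B \<mu> \<alpha> ` M_set k B \<mu>) (\<lambda>b. divergence k B \<mu> \<alpha> (phi_inv k B \<mu> \<alpha> b) Q) (F1 a) a \<and>
           has_frechet_derivative_at (Cbk k B) (Cbk_norm k B) (Cbk_dual k B) (Cbk_dual_norm k B)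
             (phi k B \<mu> \<alpha> ` M_set k B \<mu>) F1 (F2 a) a \<and>
           (\<forall>u\<in>Cbk k B. F1 a u = ip \<mu> (phi k B \<mu> (-\<alpha>) (phi_inv k B \<mu> \<alpha> a) - phi k B \<mu> (-\<alpha>) Q) u) \<and>
           (\<forall>u\<in>Cbk k B. \<forall>v\<in>Cbk k B. F2 a u v =
              integral\<^sup>L \<mu> (exp_G (\<alpha> *\<^sub>R phi k B \<mu> 1 (phi_inv k B \<mu> \<alpha> a)) * u * v))"
    proof (intro exI[of _ "grad \<alpha> Q"] exI[of _ "hess \<alpha>"] ballI conjI
        divergence_has_frechet_derivative grad_has_frechet_derivative Q)
      show "grad \<alpha> Q a u = ip \<mu> (phi k B \<mu> (-\<alpha>) (phi_inv k B \<mu> \<alpha> a) - phi k B \<mu> (-\<alpha>) Q) u"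
        if "u \<in> Cbk k B" for a u
        using that by (simp add: grad_def integral_against_def ip_def)
      show "hess \<alpha> a u v
          = integral\<^sup>L \<mu> (exp_G (\<alpha> *\<^sub>R phi k B \<mu> 1 (phi_inv k B \<mu> \<alpha> a)) * u * v)"
        if "u \<in> Cbk k B" "v \<in> Cbk k B" for a u v
        using that by (simp add: hess_def integral_against_def exp_G_def times_fun_def)
    qed
  next
    fix Q a assume Q: "Q \<in> M_set k B \<mu>" and "a \<in> phi k B \<mu> (-\<alpha>) ` M_set k B \<mu>"
    then obtain P where P: "P \<in> M_set k B \<mu>" "a = phi k B \<mu> (-\<alpha>) P" by blast
    show "let J = (\<lambda>b. ip \<mu> (a - phi k B \<mu> (-\<alpha>) Q) (b - phi k B \<mu> \<alpha> Q) - divergence k B \<mu> \<alpha> (phi_inv k B \<mu> \<alpha> b) Q);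
             b0 = phi k B \<mu> \<alpha> (phi_inv k B \<mu> (-\<alpha>) a)
         in divergence k B \<mu> (-\<alpha>) (phi_inv k B \<mu> (-\<alpha>) a) Q = J b0 \<and>
            (\<forall>b. is_arg_max J (\<lambda>b. b \<in> phi k B \<mu> \<alpha> ` M_set k B \<mu>) b \<longleftrightarrow> b = b0)"
      using legendre_maximum[OF P(1) Q, of \<alpha>] by (simp only: Let_def P phi_inv_phi simp_thms)
  qed
qed

end
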